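(* Let $q>1$ and $1<p\le 2$, and let $(u,v)$ be a weak solution of $$\Delta_p u=|v|^{q-1}v,\qquad \Delta_p v=|u|^{q-1}u\qquad\text{on }\mathbb R^N.$$ Then $u=-v$ a.e., and $u$ and $v$ are weak solutions of the scalar equation $-\Delta_p w=|w|^{q-1}w$ on $\mathbb R^N$. In particular the system admits no nonnegative nontrivial weak solutions.
   Context: $\Delta_p u=\mathrm{div}(|\nabla u|^{p-2}\nabla u)$. A pair $(u,v)$ is a weak solution of the system if $u,v\in W^{1,p}_{loc}(\mathbb R^N)$, $|u|^q,|v|^q\in L^1_{loc}(\mathbb R^N)$, and for every $\phi\in C^1_0(\mathbb R^N)$: $-\int|\nabla u|^{p-2}\nabla u\cdot\nabla\phi=\int|v|^{q-1}v\phi$ and $-\int|\nabla v|^{p-2}\nabla v\cdot\nabla\phi=\int|u|^{q-1}u\phi$. Weak solutions of the scalar equation are defined analogously. *)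

theory Defs
  imports "HOL-Analysis.Analysis"
begin

definition test_fun :: "('a::euclidean_space \<Rightarrow> real) \<Rightarrow> ('a \<Rightarrow> 'a) \<Rightarrow> bool" where
  "test_fun phi dphi \<longleftrightarrow>
     (\<forall>x. (phi has_derivative (\<lambda>h. dphi x \<bullet> h)) (at x)) \<and>
     continuous_on UNIV dphi \<and>
     (\<exists>K. compact K \<and> (\<forall>x. x \<notin> K \<longrightarrow> phi x = 0))"

definition Lp_loc :: "real \<Rightarrow> ('a::euclidean_space \<Rightarrow> real) \<Rightarrow> bool" where
  "Lp_loc r f \<longleftrightarrow> f \<in> borel_measurable lebesgue \<and>
     (\<forall>K. compact K \<longrightarrow> set_integrable lebesgue K (\<lambda>x. \<bar>f x\<bar> powr r))"

definition weak_grad :: "('a::euclidean_space \<Rightarrow> real) \<Rightarrow> ('a \<Rightarrow> 'a) \<Rightarrow> bool" where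
  "weak_grad u G \<longleftrightarrow> G \<in> borel_measurable lebesgue \<and>
     (\<forall>phi dphi. test_fun phi dphi \<longrightarrow>
        (\<forall>e. (\<integral>x. u x * (dphi x \<bullet> e) \<partial>lebesgue) = - (\<integral>x. (G x \<bullet> e) * phi x \<partial>lebesgue)))"

definition W1p_loc_grad :: "real \<Rightarrow> ('a::euclidean_space \<Rightarrow> real) \<Rightarrow> ('a \<Rightarrow> 'a) \<Rightarrow> bool" where
  "W1p_loc_grad p u G \<longleftrightarrow> Lp_loc p u \<and> weak_grad u G \<and> Lp_loc p (\<lambda>x. norm (G x))"

text \<open>Weak solution of  Delta_p u = |v|^{q-1} v,  Delta_p v = |u|^{q-1} u  on R^N.
  Convention: |grad u|^{p-2} grad u = 0 where grad u = 0 (0 powr _ = 0).\<close>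
definition weak_sol_system :: "real \<Rightarrow> real \<Rightarrow> ('a::euclidean_space \<Rightarrow> real) \<Rightarrow> ('a \<Rightarrow> real) \<Rightarrow> bool" where
  "weak_sol_system p q u v \<longleftrightarrow>
     (\<exists>Gu Gv. W1p_loc_grad p u Gu \<and> W1p_loc_grad p v Gv \<and> Lp_loc q u \<and> Lp_loc q v \<and>
       (\<forall>phi dphi. test_fun phi dphi \<longrightarrow>
          - (\<integral>x. norm (Gu x) powr (p - 2) * (Gu x \<bullet> dphi x) \<partial>lebesgue)
            = (\<integral>x. \<bar>v x\<bar> powr (q - 1) * v x * phi x \<partial>lebesgue) \<and>
          - (\<integral>x. norm (Gv x) powr (p - 2) * (Gv x \<bullet> dphi x) \<partial>lebesgue)
            = (\<integral>x. \<bar>u x\<bar> powr (q - 1) * u x * phi x \<partial>lebesgue)))"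

definition weak_sol_scalar :: "real \<Rightarrow> real \<Rightarrow> ('a::euclidean_space \<Rightarrow> real) \<Rightarrow> bool" where
  "weak_sol_scalar p q w \<longleftrightarrow>
     (\<exists>Gw. W1p_loc_grad p w Gw \<and> Lp_loc q w \<and>
       (\<forall>phi dphi. test_fun phi dphi \<longrightarrow>
          (\<integral>x. norm (Gw x) powr (p - 2) * (Gw x \<bullet> dphi x) \<partial>lebesgue)
            = (\<integral>x. \<bar>w x\<bar> powr (q - 1) * w x * phi x \<partial>lebesgue)))"

end

theory Submission
  imports Defs
begin

text \<open>The sum \<open>z = u + v\<close> satisfies \<open>div F = g\<close>, where \<open>F\<close> is the sum of the two \<open>p\<close>-fluxes and
  \<open>g\<close> the sum of the two odd powers. Both nonlinearities are odd, so these are differences of monotone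
  maps evaluated at \<open>u\<close> and \<open>-v\<close>: \<open>F \<bullet> \<nabla>z \<ge> c |F|^(p/(p-1))\<close> and \<open>g z \<ge> c |z|^(q+1)\<close>.
  Testing with \<open>\<gamma>(z) \<phi>\<close>, \<open>\<gamma>\<close> odd, bounded and increasing and \<open>\<phi>\<close> a power of a cutoff at scale \<open>R\<close>,
  and absorbing \<open>\<gamma>(z) F \<bullet> \<nabla>\<phi>\<close> by Young's inequality leaves
  \<open>\<integral> |z|^q |\<gamma>(z)| \<phi> \<le> C R^(N - p/(1-\<theta>))\<close>. A suitable \<open>\<gamma>\<close> allows \<open>\<theta>\<close> so close to 1 that the
  exponent is negative, and \<open>R \<rightarrow> \<infinity>\<close> forces \<open>z = 0\<close>. The chain rule for \<open>\<gamma>(z)\<close> is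
  obtained by mollifying \<open>z\<close>.\<close>

section \<open>Monotonicity and Young inequalities\<close>

text \<open>For \<open>z\<close> the nonlinearity has the absorbing sign: after testing, the flux
  term and the power term are both nonnegative and only the cutoff term opposes them. This is why
  neither a sign condition on \<open>u\<close>, \<open>v\<close> nor a critical exponent for
  \<open>q\<close> appears, although the scalar equation for \<open>u\<close> alone has the opposite
  sign. The obstacle is that \<open>F\<close> is not the p-flux of \<nabla>z: the operator is
  nonlinear, and \<open>F\<close> and \<nabla>z are linked by a monotonicity inequality alone. Hence
  coercivity is measured in |F|, the quantity that the cutoff term contains, and the Liouville lemma
  is stated for abstract \<open>F\<close> and \<open>g\<close>. In the Young splitting
  |\<nabla>\<phi>| ~ 1/R carries the weight (1-\<theta>)/p, so it enters with the power
  p/(1-\<theta>), on a ball of volume ~ R^N. For the chain rule, \<open>F\<close> lies only in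
  L^(p/(p-1)) and \<open>g\<close> only in L^1, locally: the mollified gradients must converge when
  paired with |F|, and the boundedness of \<gamma> must take care of \<open>g\<close>.\<close>

text \<open>Replacing both terms by the larger one gives one constant for all exponents. Exponents
  below 1, where convexity fails, do occur: the next lemma uses \<open>s - 2\<close>.\<close>

lemma powr_add_le:
  fixes a b s :: real
  assumes "a \<ge> 0" "b \<ge> 0" "s \<ge> 0"
  shows "(a + b) powr s \<le> 2 powr s * (a powr s + b powr s)"
proof -
  have "(a + b) powr s \<le> (2 * max a b) powr s" using assms by (intro powr_mono2) auto
  also have "\<dots> = 2 powr s * max a b powr s" using assms by (simp add: powr_mult)
  also have "\<dots> \<le> 2 powr s * (a powr s + b powr s)"
    by (intro mult_left_mono) (auto simp: max_def)
  finally show ?thesis .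
qed

text \<open>Strong monotonicity of X \<mapsto> |X|^(s-2) X, with \<open>Y\<close> in place of -Y
  because the map is odd. Averaging the two weights isolates |X+Y|^2; the remainder
  (A-B)(|X|^2-|Y|^2)/2 is nonnegative, since for s \<ge> 2 the weights grow with the norm.\<close>

lemma duality_map_strongly_monotone:
  fixes X Y :: "'b::real_inner"
  assumes "s \<ge> 2"
  shows "(norm X powr (s - 2) *\<^sub>R X + norm Y powr (s - 2) *\<^sub>R Y) \<bullet> (X + Y)
         \<ge> 2 powr (1 - s) * norm (X + Y) powr s"
proof -
  define A where "A = norm X powr (s - 2)"
  define B where "B = norm Y powr (s - 2)"
  have eq: "(A *\<^sub>R X + B *\<^sub>R Y) \<bullet> (X + Y) =
      (A + B) / 2 * (norm (X + Y))\<^sup>2 + (A - B) / 2 * ((norm X)\<^sup>2 - (norm Y)\<^sup>2)"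
    by (simp add: power2_norm_eq_inner inner_add_left inner_add_right inner_commute field_simps)
  have "(A - B) * ((norm X)\<^sup>2 - (norm Y)\<^sup>2) \<ge> 0"
  proof (cases "norm X \<le> norm Y")
    case True
    then have "A \<le> B" "(norm X)\<^sup>2 \<le> (norm Y)\<^sup>2" using assms by (auto simp: A_def B_def powr_mono2 power_mono)
    then show ?thesis by (simp add: mult_nonpos_nonpos)
  next
    case False
    then have "B \<le> A" "(norm Y)\<^sup>2 \<le> (norm X)\<^sup>2" using assms by (auto simp: A_def B_def powr_mono2 power_mono)
    then show ?thesis by simp
  qed
  then have 1: "(A *\<^sub>R X + B *\<^sub>R Y) \<bullet> (X + Y) \<ge> (A + B) / 2 * (norm (X + Y))\<^sup>2"
    unfolding eq by simp
  \<comment> \<open>The constant is 1/2 from the average times 2^(2-s) from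
    \<open>powr_add_le\<close> with exponent \<open>s - 2\<close>.\<close>
  have 2: "2 powr (1 - s) * norm (X + Y) powr s \<le> (A + B) / 2 * (norm (X + Y))\<^sup>2"
  proof (cases "X + Y = 0")
    case False
    have "norm (X + Y) powr (s - 2) \<le> (norm X + norm Y) powr (s - 2)"
      using assms by (intro powr_mono2 norm_triangle_ineq) auto
    also have "\<dots> \<le> 2 powr (s - 2) * (A + B)"
      unfolding A_def B_def using assms by (intro powr_add_le) auto
    finally have "2 powr (1 - s) * (norm (X + Y) powr (s - 2)) \<le> 2 powr (1 - s) * (2 powr (s - 2) * (A + B))"
      by (intro mult_left_mono) auto
    also have "\<dots> = (2 powr (1 - s) * 2 powr (s - 2)) * (A + B)" by simp
    also have "2 powr (1 - s) * 2 powr (s - 2) = (2::real) powr (- 1)" by (simp flip: powr_add)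
    finally have *: "2 powr (1 - s) * (norm (X + Y) powr (s - 2)) \<le> (A + B) / 2"
      by (simp add: powr_minus_divide)
    have "norm (X + Y) powr s = norm (X + Y) powr (s - 2) * norm (X + Y) powr 2"
      unfolding powr_add[symmetric] by simp
    also have "norm (X + Y) powr 2 = (norm (X + Y))\<^sup>2" using False by (simp add: powr_numeral)
    finally show ?thesis using mult_right_mono[OF *, of "(norm (X + Y))\<^sup>2"] by simp
  qed auto
  show ?thesis using 1 2 unfolding A_def B_def by linarith
qed

lemma norm_p_flux: "norm (norm X powr (p - 2) *\<^sub>R X) = norm X powr (p - 1)" for X :: "'b::real_normed_vector"
proof -
  have "norm (norm X powr (p - 2) *\<^sub>R X) = norm X powr (p - 2) * norm X powr 1" by simp
  also have "\<dots> = norm X powr (p - 1)" unfolding powr_add[symmetric] by simp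
  finally show ?thesis .
qed

text \<open>With \<open>s = p / (p - 1) \<ge> 2\<close> the map \<open>X \<mapsto> |X|^(s-2) X\<close> inverts the \<open>p\<close>-flux, so the
  inequality for exponents \<open>\<ge> 2\<close>, applied to the two fluxes, gives coercivity in terms of the
  flux. This is where \<open>p \<le> 2\<close> is needed.\<close>

lemma p_flux_strongly_monotone:
  fixes X Y :: "'b::real_inner"
  assumes "1 < p" "p \<le> 2"
  shows "(norm X powr (p - 2) *\<^sub>R X + norm Y powr (p - 2) *\<^sub>R Y) \<bullet> (X + Y)
         \<ge> 2 powr (1 - p / (p - 1)) * norm (norm X powr (p - 2) *\<^sub>R X + norm Y powr (p - 2) *\<^sub>R Y) powr (p / (p - 1))"
proof -
  define s where "s = p / (p - 1)"
  have s: "s \<ge> 2" using assms by (simp add: s_def field_simps)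
  \<comment> \<open>For nonzero \<open>Z\<close> the powers of its norm cancel because (p-1)(s-2) =
    2-p; at \<open>Z = 0\<close> both sides vanish.\<close>
  have inv: "norm (norm Z powr (p - 2) *\<^sub>R Z) powr (s - 2) *\<^sub>R (norm Z powr (p - 2) *\<^sub>R Z) = Z" for Z :: 'b
  proof (cases "Z = 0")
    case False
    have "norm (norm Z powr (p - 2) *\<^sub>R Z) powr (s - 2) = norm Z powr ((p - 1) * (s - 2))"
      by (simp only: norm_p_flux powr_powr)
    also have "(p - 1) * (s - 2) = 2 - p" using assms by (simp add: s_def field_simps)
    finally have e: "norm (norm Z powr (p - 2) *\<^sub>R Z) powr (s - 2) = norm Z powr (2 - p)" .
    have "norm Z powr (2 - p) * norm Z powr (p - 2) = norm Z powr 0" unfolding powr_add[symmetric] by simp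
    then have "norm Z powr (2 - p) * norm Z powr (p - 2) = 1" using False by simp
    then show ?thesis unfolding e scaleR_scaleR by simp
  qed simp
  have "2 powr (1 - s) * norm (norm X powr (p - 2) *\<^sub>R X + norm Y powr (p - 2) *\<^sub>R Y) powr s
     \<le> (X + Y) \<bullet> (norm X powr (p - 2) *\<^sub>R X + norm Y powr (p - 2) *\<^sub>R Y)"
    using duality_map_strongly_monotone[OF s, of "norm X powr (p - 2) *\<^sub>R X" "norm Y powr (p - 2) *\<^sub>R Y"]
    by (simp only: inv)
  then show ?thesis by (simp add: s_def inner_commute)
qed

text \<open>The real line is an inner product space, so this is the vector inequality with s = q+1;
  as q+1 \<ge> 2, no passage to an inverse map is involved.\<close>

lemma odd_power_strongly_monotone:
  fixes a b :: real
  assumes "q > 1"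
  shows "(\<bar>a\<bar> powr (q - 1) * a + \<bar>b\<bar> powr (q - 1) * b) * (a + b) \<ge> 2 powr (- q) * \<bar>a + b\<bar> powr (q + 1)"
  using duality_map_strongly_monotone[of "q + 1" a b] assms by (simp add: algebra_simps)

text \<open>Weighted AM-GM with all constants replaced by 1: every factor is at most a power of the
  maximum, and the exponents add up to 1.\<close>

lemma prod3_le_sum_powr:
  fixes a b c :: real
  assumes "a \<ge> 0" "b \<ge> 0" "c \<ge> 0" "\<alpha> \<ge> 0" "\<beta> \<ge> 0" "\<delta> \<ge> 0" "\<alpha> + \<beta> + \<delta> = 1"
  shows "a powr \<alpha> * b powr \<beta> * c powr \<delta> \<le> a + b + c"
proof -
  define m where "m = max a (max b c)"
  have m: "a \<le> m" "b \<le> m" "c \<le> m" "0 \<le> m" using assms by (auto simp: m_def)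
  have "a powr \<alpha> * b powr \<beta> * c powr \<delta> \<le> m powr \<alpha> * m powr \<beta> * m powr \<delta>"
    using m assms by (intro mult_mono powr_mono2) auto
  also have "\<dots> = m" using m(4) assms(7) by (simp flip: powr_add)
  also have "\<dots> \<le> a + b + c" using assms by (auto simp: m_def)
  finally show ?thesis .
qed

lemma young_with_const:
  fixes s \<sigma> :: real
  assumes "1 < p" "1 < s" "1 / p + 1 / s = 1" "\<sigma> > 0"
  obtains C where "C > 0" "\<And>w t::real. w \<ge> 0 \<Longrightarrow> t \<ge> 0 \<Longrightarrow> w * t \<le> \<sigma> * w powr s + C * t powr p"
proof -
  \<comment> \<open>Chosen so that l^s = \<sigma>. Young's inequality is applied to (l w)(t/l), and
    its denominators \<open>s\<close> and \<open>p\<close> are dropped.\<close>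
  define l where "l = \<sigma> powr (1 / s)"
  have l: "l > 0" "l powr s = \<sigma>" using assms by (auto simp: l_def powr_powr)
  show ?thesis
  proof (rule that[of "(1 / l) powr p"])
    show "0 < (1 / l) powr p" using l by simp
    fix w t :: real assume wt: "w \<ge> 0" "t \<ge> 0"
    have "w * t = (l * w) * (1 / l * t)" using l by simp
    also have "\<dots> \<le> (l * w) powr s / s + (1 / l * t) powr p / p"
      using assms wt l by (intro Youngs_inequality) auto
    also have "\<dots> \<le> (l * w) powr s / 1 + (1 / l * t) powr p / 1"
      using assms by (intro add_mono divide_left_mono) auto
    also have "\<dots> = \<sigma> * w powr s + (1 / l) powr p * t powr p"
      using wt l by (simp add: powr_mult powr_divide)
    finally show "w * t \<le> \<sigma> * w powr s + (1 / l) powr p * t powr p" .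
  qed
qed

section \<open>Test functions and cutoffs\<close>

text \<open>Inside the ball a polynomial in |x|^2, hence smooth at the origin; k \<ge> 2 makes it
  C^1 across the sphere of radius \<open>R\<close>. A large \<open>k\<close> bounds the gradient by
  a constant times bump^((k-1)/k) / R, as the absorption argument requires; k = 2 also serves as
  mollifier kernel.\<close>

definition bump :: "nat \<Rightarrow> real \<Rightarrow> 'a::euclidean_space \<Rightarrow> real" where
  "bump k R x = max 0 (1 - (x \<bullet> x) / R\<^sup>2) ^ k"

definition dbump :: "nat \<Rightarrow> real \<Rightarrow> 'a::euclidean_space \<Rightarrow> 'a" where
  "dbump k R x = (- 2 * real k / R\<^sup>2 * max 0 (1 - (x \<bullet> x) / R\<^sup>2) ^ (k - 1)) *\<^sub>R x"

text \<open>Away from 0 the function is locally a power or zero. At 0 the difference quotient is at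
  most |h|^(k-1), which tends to 0 because k \<ge> 2.\<close>

lemma pos_part_power_has_real_derivative:
  assumes "k \<ge> 2"
  shows "((\<lambda>t::real. max 0 t ^ k) has_real_derivative real k * max 0 t ^ (k - 1)) (at t)"
proof (cases "t = 0")
  case True
  have "((\<lambda>h. (max 0 h ^ k - max 0 (0::real) ^ k) / h) \<longlongrightarrow> 0) (at 0)"
  proof (rule Lim_null_comparison)
    show "\<forall>\<^sub>F h::real in at 0. norm ((max 0 h ^ k - max 0 0 ^ k) / h) \<le> \<bar>h\<bar> ^ (k - 1)"
    proof (rule eventuallyI)
      fix h :: real
      obtain m where m: "k = Suc m" "m > 0" using assms by (cases k) auto
      then show "norm ((max 0 h ^ k - max 0 0 ^ k) / h) \<le> \<bar>h\<bar> ^ (k - 1)"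
        by (cases "h > 0") (auto simp: max_def)
    qed
    show "((\<lambda>h::real. \<bar>h\<bar> ^ (k - 1)) \<longlongrightarrow> 0) (at 0)"
    proof -
      have "((\<lambda>h::real. \<bar>h\<bar> ^ (k - 1)) \<longlongrightarrow> \<bar>0\<bar> ^ (k - 1)) (at 0)"
        by (intro tendsto_intros)
      then show ?thesis using assms by (simp add: power_0_left split: if_splits)
    qed
  qed
  then show ?thesis using True assms
    by (simp add: DERIV_def power_0_left)
next
  case False
  show ?thesis
  proof (cases "t > 0")
    case True
    have "((\<lambda>t::real. t ^ k) has_real_derivative real k * t ^ (k - 1)) (at t)"
      by (auto intro!: derivative_eq_intros)
    then show ?thesis
      using True
      by (subst has_field_derivative_cong_eventually[where g = "\<lambda>t. t ^ k"])
         (auto simp: max_def intro!: eventually_mono[OF eventually_nhds_in_open[of "{0<..}"]]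
               simp: eventually_at_filter)
  next
    case F2: False
    then have t: "t < 0" using False by simp
    have "((\<lambda>t::real. 0) has_real_derivative 0) (at t)" by simp
    then show ?thesis
      using t assms
      by (subst has_field_derivative_cong_eventually[where g = "\<lambda>t. 0"])
         (auto simp: max_def power_0_left eventually_at_filter intro!: eventually_mono[OF eventually_nhds_in_open[of "{..<0}"]])
  qed
qed

lemma bump_nonneg: "0 \<le> bump k R x"
  by (simp add: bump_def)

lemma bump_eq_0:
  assumes "R > 0" "k > 0" "R \<le> norm x"
  shows "bump k R x = 0"
proof -
  have "R\<^sup>2 \<le> x \<bullet> x"
    using assms by (simp add: dot_square_norm power_mono)
  then show ?thesis using assms by (simp add: bump_def max_def field_simps)
qed

lemma bump_ge:
  assumes "R > 0" "norm x \<le> R / 2"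
  shows "bump k R x \<ge> (3/4) ^ k"
proof -
  have "x \<bullet> x \<le> (R / 2)\<^sup>2"
    using assms by (simp add: dot_square_norm power_mono)
  then have "3/4 \<le> 1 - (x \<bullet> x) / R\<^sup>2" using assms by (simp add: field_simps power2_eq_square)
  then have "3/4 \<le> max 0 (1 - (x \<bullet> x) / R\<^sup>2)" by (rule max.coboundedI2)
  then show ?thesis unfolding bump_def by (rule power_mono) simp
qed

lemma test_fun_bump:
  assumes "R > 0" "k \<ge> 2"
  shows "test_fun (bump k R :: 'a::euclidean_space \<Rightarrow> real) (dbump k R)"
  unfolding test_fun_def
proof (intro conjI allI)
  fix x :: 'a
  have d: "((\<lambda>x::'a. 1 - (x \<bullet> x) / R\<^sup>2) has_derivative (\<lambda>h. - (2 * (x \<bullet> h)) / R\<^sup>2)) (at x)"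
  proof -
    have "((\<lambda>x::'a. 1 - (x \<bullet> x) * inverse (R\<^sup>2)) has_derivative (\<lambda>h. - (2 * (x \<bullet> h)) * inverse (R\<^sup>2))) (at x)"
      by (auto intro!: derivative_eq_intros simp: inner_commute)
    then show ?thesis by (simp add: divide_inverse)
  qed
  have "((\<lambda>t::real. max 0 t ^ k) has_derivative
     (\<lambda>h. real k * max 0 (1 - (x \<bullet> x) / R\<^sup>2) ^ (k - 1) * h)) (at (1 - (x \<bullet> x) / R\<^sup>2))"
    using pos_part_power_has_real_derivative[OF assms(2), of "1 - (x \<bullet> x) / R\<^sup>2"]
    by (simp add: has_field_derivative_def)
  from has_derivative_compose[OF d this]
  show "(bump k R has_derivative (\<lambda>h. dbump k R x \<bullet> h)) (at x)"
    by (simp add: bump_def[abs_def] dbump_def mult_ac)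
next
  show "continuous_on UNIV (dbump k R :: 'a \<Rightarrow> 'a)"
    unfolding dbump_def[abs_def] using assms by (intro continuous_intros) auto
  show "\<exists>K. compact K \<and> (\<forall>x. x \<notin> K \<longrightarrow> bump k R (x::'a) = 0)"
    using assms bump_eq_0[of R k "_::'a"] by (intro exI[of _ "cball 0 R"]) auto
qed

text \<open>On the support |x| \<le> R turns x/R^2 into a factor 1/R; elsewhere the power with
  exponent k-1 \<ge> 1 vanishes. The loss of one power of the cutoff is recovered in
  \<open>absorb_flux_term\<close>.\<close>

lemma norm_dbump_le:
  assumes "R > 0" "k \<ge> 2"
  shows "norm (dbump k R x) \<le> 2 * real k / R * max 0 (1 - (x \<bullet> x) / R\<^sup>2) ^ (k - 1)"
proof (cases "norm x \<le> R")
  case True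
  let ?m = "max 0 (1 - (x \<bullet> x) / R\<^sup>2) ^ (k - 1)"
  have "norm (dbump k R x) = 2 * real k / R\<^sup>2 * ?m * norm x"
    by (simp add: dbump_def abs_mult power_abs)
  also have "\<dots> \<le> 2 * real k / R\<^sup>2 * ?m * R"
    using True by (intro mult_left_mono) auto
  also have "\<dots> = 2 * real k / R * ?m" using assms by (simp add: power2_eq_square)
  finally show ?thesis .
next
  case False
  then have "max 0 (1 - (x \<bullet> x) / R\<^sup>2) ^ (k - 1) = 0"
    using bump_eq_0[of R "k - 1" x] assms unfolding bump_def by simp
  then show ?thesis unfolding dbump_def by (simp only:) simp
qed

lemma test_fun_continuous:
  assumes "test_fun phi dphi"
  shows "continuous_on UNIV phi" "continuous_on UNIV dphi"
proof -
  show "continuous_on UNIV phi"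
    by (rule has_derivative_continuous_on[where f' = "\<lambda>x h. dphi x \<bullet> h"]) (use assms in \<open>simp add: test_fun_def\<close>)
  show "continuous_on UNIV dphi" using assms by (simp add: test_fun_def)
qed

text \<open>The definition speaks of the support of \<open>phi\<close> only. On the open complement
  of a ball \<open>phi\<close> is identically zero, so uniqueness of derivatives makes
  \<open>dphi\<close> vanish there too.\<close>

lemma test_fun_support:
  assumes "test_fun phi dphi"
  obtains r where "r > 0" "\<And>x. norm x > r \<Longrightarrow> phi x = 0" "\<And>x. norm x > r \<Longrightarrow> dphi x = 0"
proof -
  obtain K where K: "compact K" "\<And>x. x \<notin> K \<Longrightarrow> phi x = 0" using assms by (auto simp: test_fun_def)
  obtain r where r: "r > 0" "\<And>x. x \<in> K \<Longrightarrow> norm x \<le> r"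
    using compact_imp_bounded[OF K(1)] by (auto simp: bounded_pos)
  have 1: "phi x = 0" if "norm x > r" for x using K r that by force
  have "dphi x = 0" if x: "norm x > r" for x
  proof -
    have d: "(phi has_derivative (\<lambda>h. dphi x \<bullet> h)) (at x)" using assms by (auto simp: test_fun_def)
    have "((\<lambda>_. 0) has_derivative (\<lambda>h. dphi x \<bullet> h)) (at x)"
    proof (rule has_derivative_transform_within_open[OF d, of "- cball 0 r"])
      show "open (- cball (0::'a) r)" by (auto simp: open_Compl)
    qed (use 1 x in auto)
    from has_derivative_unique[OF this, of "\<lambda>_. 0"]
    have "dphi x \<bullet> dphi x = 0" by (metis has_derivative_const)
    then show ?thesis by simp
  qed
  then show ?thesis using that r 1 by blast
qed

lemma test_fun_bounded:
  assumes "test_fun phi dphi"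
  obtains B where "B > 0" "\<And>x. \<bar>phi x\<bar> \<le> B" "\<And>x. norm (dphi x) \<le> B"
proof -
  obtain r where r: "r > 0" "\<And>x. norm x > r \<Longrightarrow> phi x = 0" "\<And>x. norm x > r \<Longrightarrow> dphi x = 0"
    using test_fun_support[OF assms] by blast
  have "bounded (phi ` cball 0 r)" "bounded (dphi ` cball 0 r)"
    using test_fun_continuous[OF assms]
    by (auto intro!: compact_imp_bounded compact_continuous_image intro: continuous_on_subset)
  then obtain B1 B2 where B: "B1 > 0" "B2 > 0" "\<And>x. norm x \<le> r \<Longrightarrow> \<bar>phi x\<bar> \<le> B1"
      "\<And>x. norm x \<le> r \<Longrightarrow> norm (dphi x) \<le> B2"
    unfolding bounded_pos by (auto simp: dist_norm)
  show ?thesis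
  proof (rule that[of "max B1 B2"])
    show "\<bar>phi x\<bar> \<le> max B1 B2" for x
      using B(1) B(3)[of x] r(2)[of x] by (cases "norm x \<le> r") auto
    show "norm (dphi x) \<le> max B1 B2" for x
      using B(2) B(4)[of x] r(3)[of x] by (cases "norm x \<le> r") auto
  qed (use B in auto)
qed

lemma test_fun_translate:
  assumes "test_fun phi dphi"
  shows "test_fun (\<lambda>y. phi (y - x)) (\<lambda>y. dphi (y - x))"
  unfolding test_fun_def
proof (intro conjI allI)
  fix y
  have d: "((\<lambda>y. y - x) has_derivative (\<lambda>h. h)) (at y)" by (auto intro!: derivative_eq_intros)
  have d2: "(phi has_derivative (\<lambda>h. dphi (y - x) \<bullet> h)) (at (y - x))" using assms by (auto simp: test_fun_def)
  show "((\<lambda>y. phi (y - x)) has_derivative (\<lambda>h. dphi (y - x) \<bullet> h)) (at y)"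
    using has_derivative_compose[OF d d2] by simp
next
  show "continuous_on UNIV (\<lambda>y. dphi (y - x))"
    by (rule continuous_on_compose2[OF test_fun_continuous(2)[OF assms] _ subset_UNIV])
       (intro continuous_intros)
  obtain K where K: "compact K" "\<And>x. x \<notin> K \<Longrightarrow> phi x = 0" using assms by (auto simp: test_fun_def)
  show "\<exists>K. compact K \<and> (\<forall>y. y \<notin> K \<longrightarrow> phi (y - x) = 0)"
    using K(2) compact_translation[OF K(1), of x]
    by (intro exI[of _ "(+) x ` K"]) (force simp: image_iff)
qed

text \<open>Compact support comes from \<open>phi\<close> alone, so \<open>a\<close> may be any C^1
  function: a constant to normalise a kernel, or \<gamma> composed with a smooth approximation of
  \<open>z\<close>.\<close>

lemma test_fun_mult_left:
  assumes phi: "test_fun phi dphi"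
    and a: "\<And>x. (a has_derivative (\<lambda>h. da x \<bullet> h)) (at x)" and da: "continuous_on UNIV da"
  shows "test_fun (\<lambda>x. a x * phi x) (\<lambda>x. phi x *\<^sub>R da x + a x *\<^sub>R dphi x)"
  unfolding test_fun_def
proof (intro conjI allI)
  fix x
  have "(phi has_derivative (\<lambda>h. dphi x \<bullet> h)) (at x)" using phi by (auto simp: test_fun_def)
  from has_derivative_mult[OF a this]
  show "((\<lambda>x. a x * phi x) has_derivative (\<bullet>) (phi x *\<^sub>R da x + a x *\<^sub>R dphi x)) (at x)"
    by (rule has_derivative_eq_rhs) (simp add: fun_eq_iff inner_add_left algebra_simps)
next
  have "continuous_on UNIV a"
    by (rule has_derivative_continuous_on[where f' = "\<lambda>x h. da x \<bullet> h"]) (use a in simp)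
  then show "continuous_on UNIV (\<lambda>x. phi x *\<^sub>R da x + a x *\<^sub>R dphi x)"
    using da test_fun_continuous[OF phi] by (intro continuous_intros)
  show "\<exists>K. compact K \<and> (\<forall>x. x \<notin> K \<longrightarrow> a x * phi x = 0)"
    using phi by (force simp: test_fun_def)
qed

lemma integrable_loc_bound:
  fixes f :: "'a::euclidean_space \<Rightarrow> 'b::{banach, second_countable_topology}"
    and g :: "'a \<Rightarrow> 'c::{banach, second_countable_topology}"
  assumes "f \<in> borel_measurable borel" "set_integrable lborel (cball 0 r) g"
    and "\<And>x. norm x \<le> r \<Longrightarrow> norm (f x) \<le> B * norm (g x)" "\<And>x. norm x > r \<Longrightarrow> f x = 0"
  shows "integrable lborel f"
proof (rule Bochner_Integration.integrable_bound)
  show "integrable lborel (\<lambda>x. B * norm (indicator (cball 0 r) x *\<^sub>R g x))"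
    using assms(2) unfolding set_integrable_def by (intro integrable_mult_right integrable_norm)
  show "f \<in> borel_measurable lborel" using assms(1) by simp
  show "AE x in lborel. norm (f x) \<le> norm (B * norm (indicat_real (cball 0 r) x *\<^sub>R g x))"
  proof (rule AE_I2)
    fix x show "norm (f x) \<le> norm (B * norm (indicat_real (cball 0 r) x *\<^sub>R g x))"
    proof (cases "norm x \<le> r")
      case True
      have "B * norm (g x) \<le> \<bar>B\<bar> * norm (g x)" by (intro mult_right_mono) auto
      then show ?thesis using assms(3)[OF True] True by (simp add: abs_mult)
    next
      case False
      then show ?thesis using assms(4)[of x] by simp
    qed
  qed
qed

section \<open>Local integrability and continuity of translations\<close>

text \<open>Local L^p for Borel functions. Balls about the origin exhaust the space, and the
  nonnegative integral over \<open>lborel\<close> is the form in which translation and Fubini are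
  applied.\<close>

definition loc_pow_int :: "real \<Rightarrow> ('a::euclidean_space \<Rightarrow> 'b::euclidean_space) \<Rightarrow> bool" where
  "loc_pow_int p f \<longleftrightarrow> f \<in> borel_measurable borel \<and>
     (\<forall>r. (\<integral>\<^sup>+x. ennreal (norm (f x) powr p) * indicator (cball 0 r) x \<partial>lborel) < \<infinity>)"

lemma cball_in_sets_borel [measurable]: "cball (a::'a::euclidean_space) r \<in> sets borel"
  by simp

lemma emeasure_cball_finite: "emeasure lborel (cball (0::'a::euclidean_space) r) < \<infinity>"
  using emeasure_bounded_finite[of "cball (0::'a) r"] by simp

text \<open>Balls have finite measure and t^p \<le> 1 + t^s.\<close>

lemma loc_pow_int_mono:
  assumes "loc_pow_int s f" "0 \<le> p" "p \<le> s"
  shows "loc_pow_int p f"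
  unfolding loc_pow_int_def
proof (intro conjI allI)
  have f[measurable]: "f \<in> borel_measurable borel" using assms by (auto simp: loc_pow_int_def)
  then show "f \<in> borel_measurable borel" .
  fix r
  have "ennreal (norm (f x) powr p) \<le> 1 + ennreal (norm (f x) powr s)" for x
  proof -
    have "norm (f x) powr p \<le> 1 + norm (f x) powr s"
    proof (cases "norm (f x) \<le> 1")
      case True
      have "norm (f x) powr p \<le> 1 powr p" using True assms by (intro powr_mono2) auto
      then show ?thesis by (simp add: add_increasing2)
    next
      case False
      then have "norm (f x) powr p \<le> norm (f x) powr s" using assms by (intro powr_mono) auto
      then show ?thesis by simp
    qed
    then have "ennreal (norm (f x) powr p) \<le> ennreal (1 + norm (f x) powr s)" by (rule ennreal_leI)
    then show ?thesis by simp
  qed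
  then have "(\<integral>\<^sup>+x. ennreal (norm (f x) powr p) * indicator (cball 0 r) x \<partial>lborel)
      \<le> (\<integral>\<^sup>+x. indicator (cball 0 r) x + ennreal (norm (f x) powr s) * indicator (cball 0 r) x \<partial>lborel)"
    by (intro nn_integral_mono) (auto simp: indicator_def)
  also have "\<dots> = emeasure lborel (cball (0::'a) r) +
       (\<integral>\<^sup>+x. ennreal (norm (f x) powr s) * indicator (cball 0 r) x \<partial>lborel)"
    by (subst nn_integral_add) auto
  also have "\<dots> < \<infinity>"
    using assms(1) emeasure_cball_finite[where 'a='a, of r] by (auto simp: loc_pow_int_def)
  finally show "(\<integral>\<^sup>+x. ennreal (norm (f x) powr p) * indicator (cball 0 r) x \<partial>lborel) < \<infinity>" .
qed

lemma loc_pow_int_set_integrable: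
  assumes "loc_pow_int p f" "p \<ge> 1"
  shows "set_integrable lborel (cball 0 r) f"
proof -
  have "loc_pow_int 1 f" using assms by (auto intro: loc_pow_int_mono)
  then have f: "f \<in> borel_measurable borel" and
    i: "(\<integral>\<^sup>+x. ennreal (norm (f x) powr 1) * indicator (cball 0 r) x \<partial>lborel) < \<infinity>"
    by (auto simp: loc_pow_int_def)
  show ?thesis unfolding set_integrable_def
  proof (rule integrableI_bounded)
    have "(\<integral>\<^sup>+x. ennreal (norm (indicat_real (cball 0 r) x *\<^sub>R f x)) \<partial>lborel)
       = (\<integral>\<^sup>+x. ennreal (norm (f x) powr 1) * indicator (cball 0 r) x \<partial>lborel)"
      by (intro nn_integral_cong) (auto simp: indicator_def)
    then show "(\<integral>\<^sup>+x. ennreal (norm (indicat_real (cball 0 r) x *\<^sub>R f x)) \<partial>lborel) < \<infinity>" using i by simp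
  qed (use f in measurable)
qed

lemma AE_lborel_negligible:
  assumes "negligible N" shows "AE x in lborel. x \<notin> N"
proof -
  have "AE x in lebesgue. x \<notin> N"
    using assms by (intro AE_not_in) (simp add: negligible_iff_null_sets)
  then show ?thesis by (simp add: AE_completion_iff)
qed

text \<open>Two approximations: truncate the values of \<open>G\<close> to a ball of radius
  \<open>k\<close>, then replace \<open>G\<close> inside the truncation by continuous functions that
  converge to it almost everywhere. Both limits are dominated convergence.\<close>

lemma dense_continuous_Lp:
  fixes G :: "'a::euclidean_space \<Rightarrow> 'b::euclidean_space"
  assumes "loc_pow_int p G" "p > 0" "\<delta> > 0"
  obtains H where "continuous_on UNIV H"
    "(\<integral>\<^sup>+x. ennreal (norm (G x - H x) powr p) * indicator (cball 0 r) x \<partial>lborel) < ennreal \<delta>"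
proof -
  \<comment> \<open>Truncation of vectors as a metric projection: continuous, the identity on the
    ball of radius \<open>k\<close>, and never farther from \<open>y\<close> than the origin
    is.\<close>
  define P where "P k = closest_point (cball (0::'b) (real k))" for k
  have Pcont: "continuous_on UNIV (P k)" for k
    unfolding P_def by (intro continuous_on_closest_point) auto
  have Pnorm: "norm (P k y) \<le> real k" for k y
    using closest_point_in_set[of "cball (0::'b) (real k)" y] by (auto simp: P_def)
  have Pid: "P k y = y" if "norm y \<le> real k" for k y
    unfolding P_def using that by (intro closest_point_self) auto
  have Ple: "norm (y - P k y) \<le> norm y" for k y
    using closest_point_le[of "cball (0::'b) (real k)" 0 y] by (auto simp: P_def dist_norm)
  have G[measurable]: "G \<in> borel_measurable borel" and
    Gi: "(\<integral>\<^sup>+x. ennreal (norm (G x) powr p) * indicator (cball 0 r) x \<partial>lborel) < \<infinity>"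
    using assms(1) by (auto simp: loc_pow_int_def)
  have Pm[measurable]: "P k \<in> borel_measurable borel" for k
    using Pcont by (rule borel_measurable_continuous_onI)
  have "(\<lambda>k. \<integral>\<^sup>+x. ennreal (norm (G x - P k (G x)) powr p) * indicator (cball 0 r) x \<partial>lborel)
      \<longlonglongrightarrow> (\<integral>\<^sup>+x. 0 \<partial>(lborel :: 'a measure))"
  proof (rule nn_integral_dominated_convergence[OF _ _ _ _ Gi])
    show "AE x in lborel. ennreal (norm (G x - P j (G x)) powr p) * indicator (cball 0 r) x
       \<le> ennreal (norm (G x) powr p) * indicator (cball 0 r) x" for j
      using Ple[of "G _" j] assms(2)
      by (intro AE_I2 mult_right_mono ennreal_leI powr_mono2) auto
    show "AE x in lborel. (\<lambda>k. ennreal (norm (G x - P k (G x)) powr p) * indicator (cball 0 r) x) \<longlonglongrightarrow> 0"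
    proof (rule AE_I2)
      fix x
      have "\<forall>\<^sub>F k in sequentially. ennreal (norm (G x - P k (G x)) powr p) * indicator (cball 0 r) x = 0"
        using eventually_ge_at_top[of "nat \<lceil>norm (G x)\<rceil>"]
      proof eventually_elim
        case (elim k)
        then have "norm (G x) \<le> real k" by linarith
        then show ?case by (simp add: Pid)
      qed
      then show "(\<lambda>k. ennreal (norm (G x - P k (G x)) powr p) * indicator (cball 0 r) x) \<longlonglongrightarrow> 0"
        by (rule tendsto_eventually)
    qed
  qed auto
  then have "\<forall>\<^sub>F k in sequentially. (\<integral>\<^sup>+x. ennreal (norm (G x - P k (G x)) powr p) * indicator (cball 0 r) x \<partial>lborel) < ennreal \<delta>"
    using assms(3) by (intro order_tendstoD(2)) auto
  then obtain k where k: "(\<integral>\<^sup>+x. ennreal (norm (G x - P k (G x)) powr p) * indicator (cball 0 r) x \<partial>lborel) < ennreal \<delta>"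
    by (auto simp: eventually_sequentially)
  \<comment> \<open>This yields continuous functions converging to \<open>G\<close> off a null set,
    but without any common bound; composing them with \<open>P k\<close> supplies the dominating
    function.\<close>
  have "G measurable_on UNIV"
    by (intro lebesgue_measurable_imp_measurable_on measurable_completion) auto
  then obtain N g where N: "negligible N" and g: "\<And>n. continuous_on UNIV (g n)"
     and lim: "\<And>x. x \<notin> N \<Longrightarrow> (\<lambda>n. g n x) \<longlonglongrightarrow> G x"
    unfolding measurable_on_def by auto
  have gm[measurable]: "g n \<in> borel_measurable borel" for n
    using g by (rule borel_measurable_continuous_onI)
  have "(\<lambda>n. \<integral>\<^sup>+x. ennreal (norm (G x - P k (g n x)) powr p) * indicator (cball 0 r) x \<partial>lborel)
      \<longlonglongrightarrow> (\<integral>\<^sup>+x. ennreal (norm (G x - P k (G x)) powr p) * indicator (cball 0 r) x \<partial>lborel)"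
  proof (rule nn_integral_dominated_convergence)
    let ?w = "\<lambda>x. ennreal (2 powr p) * (ennreal (norm (G x) powr p) * indicator (cball 0 r) x)
       + ennreal (2 powr p * real k powr p) * indicator (cball 0 r) x"
    show "(\<integral>\<^sup>+x. ?w x \<partial>lborel) < \<infinity>"
      using Gi emeasure_cball_finite[where 'a='a, of r]
      by (auto simp: nn_integral_add nn_integral_cmult nn_integral_cmult_indicator ennreal_mult_less_top)
    show "AE x in lborel. ennreal (norm (G x - P k (g j x)) powr p) * indicator (cball 0 r) x \<le> ?w x" for j
    proof (rule AE_I2)
      fix x
      have "norm (G x - P k (g j x)) powr p \<le> (norm (G x) + real k) powr p"
        using Pnorm[of k "g j x"] assms(2)
        by (intro powr_mono2) (auto intro: order_trans[OF norm_triangle_ineq4])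
      also have "\<dots> \<le> 2 powr p * (norm (G x) powr p + real k powr p)"
        using assms(2) by (intro powr_add_le) auto
      finally have "ennreal (norm (G x - P k (g j x)) powr p) \<le> ennreal (2 powr p * (norm (G x) powr p + real k powr p))"
        by (rule ennreal_leI)
      then show "ennreal (norm (G x - P k (g j x)) powr p) * indicator (cball 0 r) x \<le> ?w x"
        by (auto simp: indicator_def distrib_left ennreal_mult)
    qed
    show "AE x in lborel. (\<lambda>n. ennreal (norm (G x - P k (g n x)) powr p) * indicator (cball 0 r) x)
       \<longlonglongrightarrow> ennreal (norm (G x - P k (G x)) powr p) * indicator (cball 0 r) x"
      using AE_lborel_negligible[OF N]
    proof eventually_elim
      case (elim x)
      have c: "isCont (P k) (G x)" using Pcont by (auto simp: continuous_on_eq_continuous_at)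
      have "(\<lambda>n. P k (g n x)) \<longlonglongrightarrow> P k (G x)"
        by (rule isCont_tendsto_compose[OF c lim[OF elim]])
      then have "(\<lambda>n. norm (G x - P k (g n x)) powr p) \<longlonglongrightarrow> norm (G x - P k (G x)) powr p"
        using assms(2) by (intro tendsto_powr' tendsto_intros) auto
      then have "(\<lambda>n. ennreal (norm (G x - P k (g n x)) powr p)) \<longlonglongrightarrow> ennreal (norm (G x - P k (G x)) powr p)"
        by (rule tendsto_ennrealI)
      then show ?case by (cases "x \<in> cball 0 r") auto
    qed
  qed auto
  \<comment> \<open>The limit is the very number already known to be below \<delta>, so no triangle
    inequality in L^p is needed.\<close>
  from order_tendstoD(2)[OF this k]
  obtain n where "(\<integral>\<^sup>+x. ennreal (norm (G x - P k (g n x)) powr p) * indicator (cball 0 r) x \<partial>lborel) < ennreal \<delta>"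
    by (auto simp: eventually_sequentially)
  moreover have "continuous_on UNIV (\<lambda>x. P k (g n x))"
    by (rule continuous_on_compose2[OF Pcont g subset_UNIV])
  ultimately show ?thesis using that by blast
qed

lemma nn_integral_lborel_translate:
  fixes f :: "'a::euclidean_space \<Rightarrow> ennreal"
  assumes [measurable]: "f \<in> borel_measurable borel"
  shows "(\<integral>\<^sup>+x. f (x + y) \<partial>lborel) = (\<integral>\<^sup>+x. f x \<partial>lborel)"
proof -
  have "(\<integral>\<^sup>+x. f x \<partial>lborel) = (\<integral>\<^sup>+x. f x \<partial>distr lborel borel ((+) y))" by (simp add: lborel_distr_plus)
  also have "\<dots> = (\<integral>\<^sup>+x. f (y + x) \<partial>lborel)" by (subst nn_integral_distr) auto
  finally show ?thesis by (simp add: add.commute)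
qed

text \<open>Continuity of translations in L^p, tested against a weight in the dual space L^s.
  Young's inequality with a small constant on the weight replaces Hoelder; the continuous
  approximant \<open>H\<close> is handled by uniform continuity on a compact ball. The weight will
  be |F|, or 1.\<close>

lemma translation_continuity:
  fixes G :: "'a::euclidean_space \<Rightarrow> 'b::euclidean_space" and w :: "'a \<Rightarrow> real"
  assumes G: "loc_pow_int p G" and w: "loc_pow_int s w" and w0: "\<And>x. w x \<ge> 0"
    and ps: "1 < p" "1 < s" "1 / p + 1 / s = 1" and \<sigma>: "\<sigma> > 0"
  obtains \<epsilon> where "\<epsilon> > 0" "\<And>y. norm y \<le> \<epsilon> \<Longrightarrow>
      (\<integral>\<^sup>+x. ennreal (w x * norm (G (x + y) - G x)) * indicator (cball 0 r) x \<partial>lborel) \<le> ennreal \<sigma>"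
proof -
  have [measurable]: "G \<in> borel_measurable borel" "w \<in> borel_measurable borel"
    using G w by (auto simp: loc_pow_int_def)
  define W where "W = (\<integral>\<^sup>+x. ennreal (w x powr s) * indicator (cball 0 r) x \<partial>lborel)"
  define V where "V = (\<integral>\<^sup>+x. ennreal (w x) * indicator (cball 0 r) x \<partial>lborel)"
  have "W < \<infinity>" using w w0 by (auto simp: W_def loc_pow_int_def)
  then obtain Wr where Wr: "W = ennreal Wr" "Wr \<ge> 0" by (cases W) auto
  have "loc_pow_int 1 w" using w ps by (intro loc_pow_int_mono[OF w]) auto
  then have "V < \<infinity>" using w0 by (auto simp: V_def loc_pow_int_def)
  then obtain Vr where Vr: "V = ennreal Vr" "Vr \<ge> 0" by (cases V) auto
  \<comment> \<open>The budget \<sigma> is split into thirds: 2\<tau>W for the two Young terms in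
    \<open>w\<close>, 2C\<delta> for the two approximation errors, \<kappa>V for the oscillation of
    \<open>H\<close>. The order matters: \<open>C\<close> depends on \<tau>, and \<delta> on
    \<open>C\<close>.\<close>
  define \<tau> where "\<tau> = \<sigma> / (6 * (Wr + 1))"
  have \<tau>: "\<tau> > 0" "2 * \<tau> * Wr \<le> \<sigma> / 3" using \<sigma> Wr by (auto simp: \<tau>_def field_simps)
  define \<kappa> where "\<kappa> = \<sigma> / (3 * (Vr + 1))"
  have \<kappa>: "\<kappa> > 0" "\<kappa> * Vr \<le> \<sigma> / 3" using \<sigma> Vr by (auto simp: \<kappa>_def field_simps)
  obtain C where C: "C > 0" "\<And>w t::real. w \<ge> 0 \<Longrightarrow> t \<ge> 0 \<Longrightarrow> w * t \<le> \<tau> * w powr s + C * t powr p"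
    using young_with_const[OF ps \<tau>(1)] by blast
  define \<delta> where "\<delta> = \<sigma> / (6 * C)"
  have \<delta>: "\<delta> > 0" "C * \<delta> = \<sigma> / 6" using \<sigma> C by (auto simp: \<delta>_def)
  \<comment> \<open>Radius \<open>r + 1\<close> because shifts by at most 1 move the ball of radius
    \<open>r\<close> into it.\<close>
  obtain H where H: "continuous_on UNIV H"
    "(\<integral>\<^sup>+x. ennreal (norm (G x - H x) powr p) * indicator (cball 0 (r + 1)) x \<partial>lborel) < ennreal \<delta>"
    using dense_continuous_Lp[OF G _ \<delta>(1)] ps by auto
  have [measurable]: "H \<in> borel_measurable borel" using H(1) by (rule borel_measurable_continuous_onI)
  define A where "A x = ennreal (norm (G x - H x) powr p) * indicator (cball 0 (r + 1)) x" for x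
  have [measurable]: "A \<in> borel_measurable borel" unfolding A_def by measurable
  have A: "(\<integral>\<^sup>+x. A x \<partial>lborel) \<le> ennreal \<delta>" using H(2) by (simp add: A_def)
  have "uniformly_continuous_on (cball 0 (r + 1)) H"
    using H(1) by (intro compact_uniformly_continuous) (auto intro: continuous_on_subset)
  then obtain d where d: "d > 0" "\<And>x x'. x \<in> cball 0 (r + 1) \<Longrightarrow> x' \<in> cball 0 (r + 1) \<Longrightarrow> dist x' x < d \<Longrightarrow> dist (H x') (H x) < \<kappa>"
    unfolding uniformly_continuous_on_def using \<kappa>(1) by metis
  show ?thesis
  proof (rule that[of "min 1 (d / 2)"])
    show "min 1 (d / 2) > 0" using d by simp
    fix y :: 'a assume y: "norm y \<le> min 1 (d / 2)"
    have "ennreal (w x * norm (G (x + y) - G x)) * indicator (cball 0 r) x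
      \<le> ennreal (2 * \<tau>) * (ennreal (w x powr s) * indicator (cball 0 r) x) + ennreal C * A (x + y) + ennreal C * A x
        + ennreal \<kappa> * (ennreal (w x) * indicator (cball 0 r) x)" for x
    proof (cases "x \<in> cball 0 r")
      case True
      then have x: "x \<in> cball 0 (r + 1)" "x + y \<in> cball 0 (r + 1)"
        using y norm_triangle_ineq[of x y] by auto
      have "dist (H (x + y)) (H x) < \<kappa>" using y d(1) by (intro d(2) x) (auto simp: dist_norm)
      then have h: "norm (H (x + y) - H x) \<le> \<kappa>" by (simp add: dist_norm)
      have "G (x + y) - G x = (G (x + y) - H (x + y)) + (H (x + y) - H x) - (G x - H x)" by simp
      then have "norm (G (x + y) - G x) \<le> norm (G (x + y) - H (x + y)) + norm (H (x + y) - H x) + norm (G x - H x)"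
        using norm_triangle_ineq4[of "(G (x + y) - H (x + y)) + (H (x + y) - H x)" "G x - H x"]
          norm_triangle_ineq[of "G (x + y) - H (x + y)" "H (x + y) - H x"] by simp
      then have "w x * norm (G (x + y) - G x) \<le> w x * (norm (G (x + y) - H (x + y)) + \<kappa> + norm (G x - H x))"
        using h by (intro mult_left_mono w0) auto
      also have "\<dots> = w x * norm (G (x + y) - H (x + y)) + w x * norm (G x - H x) + \<kappa> * w x" by (simp add: algebra_simps)
      also have "\<dots> \<le> (\<tau> * w x powr s + C * norm (G (x + y) - H (x + y)) powr p)
           + (\<tau> * w x powr s + C * norm (G x - H x) powr p) + \<kappa> * w x"
        by (intro add_mono C(2) w0) auto
      also have "\<dots> = 2 * \<tau> * w x powr s + C * norm (G (x + y) - H (x + y)) powr p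
           + C * norm (G x - H x) powr p + \<kappa> * w x" by simp
      finally have "ennreal (w x * norm (G (x + y) - G x)) \<le> ennreal \<dots>" by (rule ennreal_leI)
      also have "\<dots> = ennreal (2 * \<tau>) * ennreal (w x powr s) + ennreal C * ennreal (norm (G (x + y) - H (x + y)) powr p)
           + ennreal C * ennreal (norm (G x - H x) powr p) + ennreal \<kappa> * ennreal (w x)"
        using C(1) \<tau>(1) \<kappa>(1) w0[of x] by (simp add: ennreal_mult ennreal_plus)
      finally show ?thesis using True x by (simp add: A_def)
    qed auto
    then have "(\<integral>\<^sup>+x. ennreal (w x * norm (G (x + y) - G x)) * indicator (cball 0 r) x \<partial>lborel)
      \<le> (\<integral>\<^sup>+x. ennreal (2 * \<tau>) * (ennreal (w x powr s) * indicator (cball 0 r) x) + ennreal C * A (x + y) + ennreal C * A x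
        + ennreal \<kappa> * (ennreal (w x) * indicator (cball 0 r) x) \<partial>lborel)"
      by (rule nn_integral_mono)
    also have "\<dots> = ennreal (2 * \<tau>) * W + ennreal C * (\<integral>\<^sup>+x. A (x + y) \<partial>lborel) + ennreal C * (\<integral>\<^sup>+x. A x \<partial>lborel)
        + ennreal \<kappa> * V"
      unfolding W_def V_def by (simp add: nn_integral_add nn_integral_cmult)
    also have "(\<integral>\<^sup>+x. A (x + y) \<partial>lborel) = (\<integral>\<^sup>+x. A x \<partial>lborel)"
      by (rule nn_integral_lborel_translate) simp
    also have "ennreal (2 * \<tau>) * W + ennreal C * (\<integral>\<^sup>+x. A x \<partial>lborel) + ennreal C * (\<integral>\<^sup>+x. A x \<partial>lborel) + ennreal \<kappa> * V
      \<le> ennreal (2 * \<tau>) * W + ennreal C * ennreal \<delta> + ennreal C * ennreal \<delta> + ennreal \<kappa> * V"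
      by (intro add_mono mult_left_mono A) auto
    also have "\<dots> = ennreal (2 * \<tau> * Wr + C * \<delta> + C * \<delta> + \<kappa> * Vr)"
      using \<tau>(1) C(1) \<delta>(1) \<kappa>(1) Wr Vr
      by (simp add: ennreal_mult[symmetric] ennreal_plus[symmetric] del: ennreal_plus)
    also have "\<dots> \<le> ennreal \<sigma>" using \<tau>(2) \<delta>(2) \<kappa>(2) by (intro ennreal_leI) auto
    finally show "(\<integral>\<^sup>+x. ennreal (w x * norm (G (x + y) - G x)) * indicator (cball 0 r) x \<partial>lborel) \<le> ennreal \<sigma>" .
  qed
qed

section \<open>Mollification\<close>

text \<open>The kernel is evaluated at \<open>y - x\<close> rather than \<open>x - y\<close>, so that only translations, and no
  reflections, of Lebesgue measure and of test functions are needed.\<close>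

definition moll :: "('a::euclidean_space \<Rightarrow> real) \<Rightarrow> ('a \<Rightarrow> 'b::euclidean_space) \<Rightarrow> 'a \<Rightarrow> 'b" where
  "moll K f x = (\<integral>y. K (y - x) *\<^sub>R f y \<partial>lborel)"

text \<open>For points closer than 1, either both lie in the ball of radius r+1, where compactness
  applies, or both values are zero.\<close>

lemma cont_compact_support_uniform:
  fixes f :: "'a::euclidean_space \<Rightarrow> 'b::real_normed_vector"
  assumes "continuous_on UNIV f" "\<And>x. norm x > r \<Longrightarrow> f x = 0" "e > 0"
  obtains d where "d > 0" "d \<le> 1" "\<And>a b. norm (a - b) < d \<Longrightarrow> norm (f a - f b) \<le> e"
proof -
  have "uniformly_continuous_on (cball 0 (r + 1)) f"
    using assms(1) by (intro compact_uniformly_continuous) (auto intro: continuous_on_subset)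
  then obtain d where d: "d > 0" "\<And>x x'. x \<in> cball 0 (r + 1) \<Longrightarrow> x' \<in> cball 0 (r + 1) \<Longrightarrow> dist x' x < d \<Longrightarrow> dist (f x') (f x) < e"
    unfolding uniformly_continuous_on_def using assms(3) by metis
  show ?thesis
  proof (rule that[of "min d 1"])
    fix a b :: 'a assume ab: "norm (a - b) < min d 1"
    show "norm (f a - f b) \<le> e"
    proof (cases "norm a \<le> r \<or> norm b \<le> r")
      case True
      have "norm a \<le> norm b + norm (a - b)" "norm b \<le> norm a + norm (a - b)"
        by norm+
      then have "a \<in> cball 0 (r + 1)" "b \<in> cball 0 (r + 1)" using True ab by auto
      from d(2)[OF this(2,1)] ab show ?thesis by (simp add: dist_norm)
    next
      case False
      then show ?thesis using assms(2)[of a] assms(2)[of b] assms(3) by simp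
    qed
  qed (use d in auto)
qed

text \<open>The mean value inequality with uniformly continuous gradient. Uniformity in the base
  point is what permits differentiation under the convolution integral.\<close>

lemma test_fun_uniform_linearization:
  assumes "test_fun K dK" "e > 0"
  obtains d where "d > 0" "d \<le> 1" "\<And>a h. norm h < d \<Longrightarrow> \<bar>K (a + h) - K a - dK a \<bullet> h\<bar> \<le> e * norm h"
proof -
  obtain r where r: "r > 0" "\<And>x. norm x > r \<Longrightarrow> K x = 0" "\<And>x. norm x > r \<Longrightarrow> dK x = 0"
    using test_fun_support[OF assms(1)] by blast
  obtain d where d: "d > 0" "d \<le> 1" "\<And>a b. norm (a - b) < d \<Longrightarrow> norm (dK a - dK b) \<le> e"
    using cont_compact_support_uniform[OF test_fun_continuous(2)[OF assms(1)] r(3) assms(2)] by blast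
  show ?thesis
  proof (rule that[OF d(1,2)])
    fix a h :: 'a assume h: "norm h < d"
    have "norm (K (a + h) - K a - dK a \<bullet> (a + h - a)) \<le> norm (a + h - a) * e"
    proof (rule differentiable_bound_linearization[where S = "ball a d" and f' = "\<lambda>x h. dK x \<bullet> h"])
      fix t :: real assume "t \<in> {0..1}"
      then have "norm (t *\<^sub>R h) \<le> norm h" by (simp add: mult_left_le_one_le)
      then show "a + t *\<^sub>R (a + h - a) \<in> ball a d" using h by (simp add: dist_norm)
    next
      fix x assume "x \<in> ball a d"
      then have "norm (x - a) < d" by (simp add: dist_norm norm_minus_commute)
      from d(3)[OF this] have le: "norm (dK x - dK a) \<le> e" .
      show "onorm ((\<lambda>h. dK x \<bullet> h) - (\<lambda>h. dK a \<bullet> h)) \<le> e"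
        unfolding fun_diff_def
      proof (rule onorm_le)
        fix h
        have "norm (dK x \<bullet> h - dK a \<bullet> h) = \<bar>(dK x - dK a) \<bullet> h\<bar>" by (simp add: inner_diff_left)
        also have "\<dots> \<le> norm (dK x - dK a) * norm h" by (rule Cauchy_Schwarz_ineq2)
        also have "\<dots> \<le> e * norm h" using le by (rule mult_right_mono) simp
        finally show "norm (dK x \<bullet> h - dK a \<bullet> h) \<le> e * norm h" .
      qed
    qed (use assms(1) d(1) in \<open>auto simp: test_fun_def intro: has_derivative_at_withinI\<close>)
    then show "\<bar>K (a + h) - K a - dK a \<bullet> h\<bar> \<le> e * norm h" by (simp add: mult.commute)
  qed
qed

lemma moll_integrable:
  fixes f :: "'a::euclidean_space \<Rightarrow> 'b::euclidean_space"
  assumes K: "continuous_on UNIV K" "\<And>x. norm x > r \<Longrightarrow> K x = 0"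
    and f: "f \<in> borel_measurable borel" "\<And>\<rho>. set_integrable lborel (cball 0 \<rho>) f"
  shows "integrable lborel (\<lambda>y. K (y - x) *\<^sub>R f y)"
proof -
  have [measurable]: "K \<in> borel_measurable borel" using K(1) by (rule borel_measurable_continuous_onI)
  have "bounded (K ` cball 0 r)"
    using K(1) by (auto intro!: compact_imp_bounded compact_continuous_image intro: continuous_on_subset)
  then obtain B where B: "B > 0" "\<And>x. norm x \<le> r \<Longrightarrow> \<bar>K x\<bar> \<le> B" unfolding bounded_pos by force
  have B': "\<bar>K x\<bar> \<le> B" for x using B K(2)[of x] by (cases "norm x \<le> r") auto
  show ?thesis
  proof (rule integrable_loc_bound[OF _ f(2)[of "norm x + r"], where B = B])
    show "(\<lambda>y. K (y - x) *\<^sub>R f y) \<in> borel_measurable borel" using f(1) by measurable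
    show "norm (K (y - x) *\<^sub>R f y) \<le> B * norm (f y)" for y using B'[of "y - x"] by (simp add: mult_right_mono)
    fix y :: 'a assume "norm y > norm x + r"
    then have "norm (y - x) > r" by norm
    then show "K (y - x) *\<^sub>R f y = 0" using K(2) by simp
  qed
qed

lemma moll_continuous:
  fixes f :: "'a::euclidean_space \<Rightarrow> 'b::euclidean_space"
  assumes K: "continuous_on UNIV K" "\<And>x. norm x > r \<Longrightarrow> K x = 0"
    and f: "f \<in> borel_measurable borel" "\<And>\<rho>. set_integrable lborel (cball 0 \<rho>) f"
  shows "continuous_on UNIV (moll K f)"
  unfolding continuous_on_iff
proof (intro ballI allI impI)
  fix x :: 'a and e :: real assume e: "e > 0"
  have [measurable]: "K \<in> borel_measurable borel" using K(1) by (rule borel_measurable_continuous_onI)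
  define S where "S = cball (0::'a) (norm x + 1 + r)"
  define I where "I = (\<integral>y. norm (indicator S y *\<^sub>R f y) \<partial>lborel)"
  have I0: "I \<ge> 0" by (simp add: I_def)
  have i: "integrable lborel (\<lambda>y. K (y - a) *\<^sub>R f y)" for a
    by (rule moll_integrable[OF K f])
  \<comment> \<open>The summand 1 covers I = 0, and the factor 2 makes the final estimate
    strict.\<close>
  have e': "e / (2 * (I + 1)) > 0" using e I0 by simp
  obtain d where d: "d > 0" "d \<le> 1" "\<And>a b. norm (a - b) < d \<Longrightarrow> norm (K a - K b) \<le> e / (2 * (I + 1))"
    using cont_compact_support_uniform[OF K e'] by blast
  show "\<exists>d>0. \<forall>x'\<in>UNIV. dist x' x < d \<longrightarrow> dist (moll K f x') (moll K f x) < e"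
  proof (intro exI conjI ballI impI)
    show "d > 0" by fact
    fix x' assume x': "dist x' x < d"
    have n: "norm x' \<le> norm x + 1" using x' d(2) by (simp add: dist_norm) norm
    have "moll K f x' - moll K f x = (\<integral>y. K (y - x') *\<^sub>R f y - K (y - x) *\<^sub>R f y \<partial>lborel)"
      unfolding moll_def using i by (intro Bochner_Integration.integral_diff[symmetric]) auto
    also have "norm \<dots> \<le> (\<integral>y. norm (K (y - x') *\<^sub>R f y - K (y - x) *\<^sub>R f y) \<partial>lborel)" by (rule integral_norm_bound)
    also have "\<dots> \<le> (\<integral>y. e / (2 * (I + 1)) * norm (indicator S y *\<^sub>R f y) \<partial>lborel)"
    proof (rule integral_mono)
      show "integrable lborel (\<lambda>y. norm (K (y - x') *\<^sub>R f y - K (y - x) *\<^sub>R f y))"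
        by (intro integrable_norm Bochner_Integration.integrable_diff i)
      show "integrable lborel (\<lambda>y. e / (2 * (I + 1)) * norm (indicator S y *\<^sub>R f y))"
        using f(2)[of "norm x + 1 + r"] unfolding S_def set_integrable_def
        by (intro integrable_mult_right integrable_norm)
      fix y
      show "norm (K (y - x') *\<^sub>R f y - K (y - x) *\<^sub>R f y) \<le> e / (2 * (I + 1)) * norm (indicator S y *\<^sub>R f y)"
      proof (cases "y \<in> S")
        case True
        have "norm (K (y - x') - K (y - x)) \<le> e / (2 * (I + 1))"
          using x' by (intro d(3)) (simp add: dist_norm norm_minus_commute)
        from mult_right_mono[OF this, of "norm (f y)"] show ?thesis using True
          by (simp flip: scaleR_diff_left)
      next
        case False
        then have ny: "norm y > norm x + 1 + r" by (simp add: S_def)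
        have "norm (y - x) > r" using ny by norm
        moreover have "norm (y - x') > r" using ny n by norm
        ultimately show ?thesis using K(2) False by simp
      qed
    qed
    also have "\<dots> = e / (2 * (I + 1)) * I" by (simp add: I_def)
    also have "\<dots> < e" using e I0 by (simp add: field_simps add_nonneg_pos)
    finally show "dist (moll K f x') (moll K f x) < e" by (simp add: dist_norm)
  qed
qed

text \<open>Differentiating the kernel in x gives -dK(y-x), and the weak gradient identity with the
  translated kernel as test function moves the derivative onto \<open>z\<close>; the two signs
  cancel. Thus the gradient of the mollification is the mollified weak gradient.\<close>

lemma moll_has_derivative:
  fixes z :: "'a::euclidean_space \<Rightarrow> real" and G :: "'a \<Rightarrow> 'a"
  assumes K: "test_fun K dK"
    and z: "z \<in> borel_measurable borel" "\<And>\<rho>. set_integrable lborel (cball 0 \<rho>) z"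
    and G: "G \<in> borel_measurable borel" "\<And>\<rho>. set_integrable lborel (cball 0 \<rho>) G"
    and weak: "\<And>phi dphi e. test_fun phi dphi \<Longrightarrow>
       (\<integral>x. z x * (dphi x \<bullet> e) \<partial>lborel) = - (\<integral>x. (G x \<bullet> e) * phi x \<partial>lborel)"
  shows "(moll K z has_derivative (\<lambda>h. moll K G x \<bullet> h)) (at x)"
  unfolding has_derivative_at_alt
proof (intro conjI allI impI)
  show "bounded_linear (\<lambda>h. moll K G x \<bullet> h)" by (rule bounded_linear_inner_right)
  fix e :: real assume e: "e > 0"
  obtain r where r: "r > 0" "\<And>x. norm x > r \<Longrightarrow> K x = 0" "\<And>x. norm x > r \<Longrightarrow> dK x = 0"
    using test_fun_support[OF K] by blast
  note Kc = test_fun_continuous[OF K]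
  have [measurable]: "K \<in> borel_measurable borel" "dK \<in> borel_measurable borel"
    using Kc by (auto intro: borel_measurable_continuous_onI)
  define S where "S = cball (0::'a) (norm x + 1 + r)"
  define I where "I = (\<integral>y. norm (indicator S y *\<^sub>R z y) \<partial>lborel)"
  have I0: "I \<ge> 0" by (simp add: I_def)
  have e': "e / (I + 1) > 0" using e I0 by simp
  obtain d where d: "d > 0" "d \<le> 1" "\<And>a h. norm h < d \<Longrightarrow> \<bar>K (a + h) - K a - dK a \<bullet> h\<bar> \<le> e / (I + 1) * norm h"
    using test_fun_uniform_linearization[OF K e'] by blast
  show "\<exists>d>0. \<forall>x'. norm (x' - x) < d \<longrightarrow>
     norm (moll K z x' - moll K z x - moll K G x \<bullet> (x' - x)) \<le> e * norm (x' - x)"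
  proof (intro exI conjI allI impI)
    show "d > 0" by fact
    fix x' assume x': "norm (x' - x) < d"
    define h where "h = x' - x"
    have n: "norm x' \<le> norm x + 1" using x' d(2) by norm
    have "continuous_on UNIV (\<lambda>y. dK y \<bullet> h)" using Kc by (intro continuous_intros)
    then have i3: "integrable lborel (\<lambda>y. (dK (y - x) \<bullet> h) *\<^sub>R z y)"
      by (rule moll_integrable[of _ r]) (use r z in auto)
    have i: "integrable lborel (\<lambda>y. K (y - a) *\<^sub>R z y)" for a
      by (rule moll_integrable[OF Kc(1) r(2) z])
    note i12 = i[of x'] i[of x]
    have "moll K G x \<bullet> h = (\<integral>y. (K (y - x) *\<^sub>R G y) \<bullet> h \<partial>lborel)"
      unfolding moll_def
      by (rule integral_inner_left[symmetric]) (use moll_integrable[OF Kc(1) r(2) G] in auto)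
    also have "\<dots> = (\<integral>y. (G y \<bullet> h) * K (y - x) \<partial>lborel)" by (simp add: mult.commute)
    also have "\<dots> = - (\<integral>y. z y * (dK (y - x) \<bullet> h) \<partial>lborel)"
      using weak[OF test_fun_translate[OF K, of x], of h] by simp
    finally have g: "moll K G x \<bullet> h = - (\<integral>y. (dK (y - x) \<bullet> h) *\<^sub>R z y \<partial>lborel)" by (simp add: mult.commute)
    have "moll K z x' - moll K z x - moll K G x \<bullet> h =
        (\<integral>y. (K (y - x') *\<^sub>R z y - K (y - x) *\<^sub>R z y) + (dK (y - x) \<bullet> h) *\<^sub>R z y \<partial>lborel)"
      unfolding g unfolding moll_def using i12 i3 by simp
    also have "\<dots> = (\<integral>y. (K (y - x') - K (y - x) + dK (y - x) \<bullet> h) * z y \<partial>lborel)"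
      by (simp add: algebra_simps)
    also have "norm \<dots> \<le> (\<integral>y. norm ((K (y - x') - K (y - x) + dK (y - x) \<bullet> h) * z y) \<partial>lborel)" by (rule integral_norm_bound)
    also have "\<dots> \<le> (\<integral>y. e / (I + 1) * norm h * norm (indicator S y *\<^sub>R z y) \<partial>lborel)"
    proof (rule integral_mono)
      have "integrable lborel (\<lambda>y. (K (y - x') *\<^sub>R z y - K (y - x) *\<^sub>R z y) + (dK (y - x) \<bullet> h) *\<^sub>R z y)"
        using i12 i3 by simp
      then show "integrable lborel (\<lambda>y. norm ((K (y - x') - K (y - x) + dK (y - x) \<bullet> h) * z y))"
        by (intro integrable_norm) (simp add: algebra_simps)
      show "integrable lborel (\<lambda>y. e / (I + 1) * norm h * norm (indicator S y *\<^sub>R z y))"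
        using z(2)[of "norm x + 1 + r"] unfolding S_def set_integrable_def
        by (intro integrable_mult_right integrable_norm)
      fix y
      show "norm ((K (y - x') - K (y - x) + dK (y - x) \<bullet> h) * z y) \<le> e / (I + 1) * norm h * norm (indicator S y *\<^sub>R z y)"
      proof (cases "y \<in> S")
        case True
        \<comment> \<open>The linearization is used at base point y-x with increment -h, since
          moving x by h moves the kernel argument by -h.\<close>
        have eq: "(y - x) + (- h) = y - x'" by (simp add: h_def)
        have "\<bar>K ((y - x) + (- h)) - K (y - x) - dK (y - x) \<bullet> (- h)\<bar> \<le> e / (I + 1) * norm (- h)"
          using x' by (intro d(3)) (simp add: h_def norm_minus_commute)
        then have "\<bar>K (y - x') - K (y - x) + dK (y - x) \<bullet> h\<bar> \<le> e / (I + 1) * norm h"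
          unfolding eq norm_minus_cancel inner_minus_right by simp
        from mult_right_mono[OF this, of "\<bar>z y\<bar>"] show ?thesis using True by (simp add: abs_mult)
      next
        case False
        then have ny: "norm y > norm x + 1 + r" by (simp add: S_def)
        have "norm (y - x) > r" using ny by norm
        moreover have "norm (y - x') > r" using ny n by norm
        ultimately show ?thesis using r False by simp
      qed
    qed
    also have "\<dots> = e / (I + 1) * I * norm h" by (simp add: I_def)
    also have "\<dots> \<le> e * norm h" using e I0 by (intro mult_right_mono) (simp_all add: field_simps)
    finally show "norm (moll K z x' - moll K z x - moll K G x \<bullet> (x' - x)) \<le> e * norm (x' - x)"
      by (simp add: h_def)
  qed
qed

lemma mollifier_exists:
  assumes "\<epsilon> > 0"
  obtains K dK where "test_fun (K :: 'a::euclidean_space \<Rightarrow> real) dK" "\<And>x. K x \<ge> 0" "\<And>x. norm x > \<epsilon> \<Longrightarrow> K x = 0"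
    "(\<integral>x. K x \<partial>lborel) = 1" "integrable lborel K"
proof -
  let ?b = "bump 2 \<epsilon> :: 'a \<Rightarrow> real"
  define c where "c = (\<integral>x. ?b x \<partial>lborel)"
  have t: "test_fun ?b (dbump 2 \<epsilon>)" using assms by (intro test_fun_bump) auto
  have cont: "continuous_on UNIV ?b" using test_fun_continuous[OF t] by simp
  have supp: "?b x = 0" if "norm x > \<epsilon>" for x using that assms by (intro bump_eq_0) auto
  have c0: "set_integrable lborel (cball 0 \<epsilon>) ?b"
    unfolding set_integrable_def
    by (rule borel_integrable_compact) (auto intro: continuous_on_subset[OF cont])
  have int: "integrable lborel ?b"
    by (rule integrable_loc_bound[OF _ c0, where B = 1])
      (use supp cont in \<open>auto intro: borel_measurable_continuous_onI\<close>)
  have "c > 0"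
  proof -
    \<comment> \<open>9/16 is (3/4)^2, the lower bound of the kernel with k = 2 on the half ball,
      which has positive volume.\<close>
    have "(\<integral>x. (9/16) * indicator (cball 0 (\<epsilon>/2)) x \<partial>(lborel :: 'a measure)) \<le> c"
      unfolding c_def
    proof (rule integral_mono[OF _ int])
      show "integrable lborel (\<lambda>x::'a. 9/16 * indicat_real (cball 0 (\<epsilon>/2)) x)"
        using emeasure_cball_finite[where 'a='a] by (intro integrable_mult_right integrable_real_indicator) auto
      show "9/16 * indicat_real (cball 0 (\<epsilon>/2)) x \<le> ?b x" for x
        using bump_ge[OF assms, of x 2] bump_nonneg[of 2 \<epsilon> x]
        by (auto simp: indicator_def power2_eq_square)
    qed
    then have "9 / 16 * measure lborel (cball (0::'a) (\<epsilon>/2)) \<le> c" by simp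
    moreover have "measure lborel (cball (0::'a) (\<epsilon>/2)) > 0"
      using assms content_cball_pos[of "\<epsilon>/2" "0::'a"] by simp
    ultimately show ?thesis by linarith
  qed
  show ?thesis
  proof (rule that[of "\<lambda>x. inverse c * ?b x" "\<lambda>x. inverse c *\<^sub>R dbump 2 \<epsilon> x"])
    show "test_fun (\<lambda>x. inverse c * ?b x) (\<lambda>x. inverse c *\<^sub>R dbump 2 \<epsilon> x)"
      using test_fun_mult_left[OF t, of "\<lambda>_. inverse c" "\<lambda>_. 0"] by simp
    show "0 \<le> inverse c * ?b x" for x
      using bump_nonneg[of 2 \<epsilon> x] \<open>c > 0\<close> by simp
  qed (use \<open>c > 0\<close> int supp in \<open>auto simp flip: c_def\<close>)
qed

text \<open>Unit mass lets \<open>f x\<close> be written as an average with the same kernel;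
  translating the variable then exposes the shifts f(x+t) - f(x).\<close>

lemma moll_diff_le:
  fixes f :: "'a::euclidean_space \<Rightarrow> 'b::euclidean_space"
  assumes K: "continuous_on UNIV K" "\<And>x. norm x > \<epsilon> \<Longrightarrow> K x = 0" "\<And>x. K x \<ge> 0" "(\<integral>x. K x \<partial>lborel) = 1" "integrable lborel K"
    and f: "f \<in> borel_measurable borel" "\<And>\<rho>. set_integrable lborel (cball 0 \<rho>) f"
  shows "ennreal (norm (moll K f x - f x)) \<le> (\<integral>\<^sup>+t. ennreal (K t) * ennreal (norm (f (x + t) - f x)) \<partial>lborel)"
proof -
  have [measurable]: "K \<in> borel_measurable borel" using K(1) by (rule borel_measurable_continuous_onI)
  note [measurable] = f(1)
  have iK: "integrable lborel (\<lambda>y. K (y - x))" "(\<integral>y. K (y - x) \<partial>lborel) = 1"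
  proof -
    have "(\<integral>y. K y \<partial>lborel) = (\<integral>y. K y \<partial>distr lborel borel ((+) (- x)))" by (simp add: lborel_distr_plus)
    also have "\<dots> = (\<integral>y. K (y - x) \<partial>lborel)" by (subst integral_distr) auto
    finally show "(\<integral>y. K (y - x) \<partial>lborel) = 1" using K(4) by simp
    have "integrable (distr lborel borel ((+) (- x))) K" using K(5) by (simp add: lborel_distr_plus)
    then show "integrable lborel (\<lambda>y. K (y - x))" by (subst (asm) integrable_distr_eq) auto
  qed
  have "moll K f x - f x = (\<integral>y. K (y - x) *\<^sub>R f y \<partial>lborel) - (\<integral>y. K (y - x) *\<^sub>R f x \<partial>lborel)"
    using iK by (simp add: moll_def)
  also have "\<dots> = (\<integral>y. K (y - x) *\<^sub>R (f y - f x) \<partial>lborel)"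
    using iK moll_integrable[OF K(1,2) f, where x = x]
    by (subst Bochner_Integration.integral_diff[symmetric]) (auto simp: scaleR_diff_right)
  finally have "ennreal (norm (moll K f x - f x)) \<le> (\<integral>\<^sup>+y. ennreal (norm (K (y - x) *\<^sub>R (f y - f x))) \<partial>lborel)"
    using iK moll_integrable[OF K(1,2) f, where x = x]
    by (simp only:) (rule integral_norm_bound_ennreal, simp add: scaleR_diff_right)
  also have "\<dots> = (\<integral>\<^sup>+t. ennreal (norm (K (t + x - x) *\<^sub>R (f (t + x) - f x))) \<partial>lborel)"
    by (rule nn_integral_lborel_translate[symmetric]) simp
  also have "\<dots> = (\<integral>\<^sup>+t. ennreal (K t) * ennreal (norm (f (x + t) - f x)) \<partial>lborel)"
    using K(3) by (simp add: ennreal_mult add.commute)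
  finally show ?thesis .
qed

text \<open>Fubini exchanges the kernel average with the weighted integral; only shifts of norm at
  most \<epsilon> carry mass, so the translation estimate survives averaging with the same
  bound.\<close>

lemma moll_weighted_diff_le:
  fixes f :: "'a::euclidean_space \<Rightarrow> 'b::euclidean_space"
  assumes K: "continuous_on UNIV K" "\<And>x. norm x > \<epsilon> \<Longrightarrow> K x = 0" "\<And>x. K x \<ge> 0" "(\<integral>x. K x \<partial>lborel) = 1" "integrable lborel K"
    and f: "f \<in> borel_measurable borel" "\<And>\<rho>. set_integrable lborel (cball 0 \<rho>) f"
    and w: "w \<in> borel_measurable borel" "\<And>x. w x \<ge> 0"
    and le: "\<And>y. norm y \<le> \<epsilon> \<Longrightarrow>
      (\<integral>\<^sup>+x. ennreal (w x * norm (f (x + y) - f x)) * indicator (cball 0 r) x \<partial>lborel) \<le> ennreal \<sigma>"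
  shows "(\<integral>\<^sup>+x. ennreal (w x * norm (moll K f x - f x)) * indicator (cball 0 r) x \<partial>lborel) \<le> ennreal \<sigma>"
proof -
  have [measurable]: "K \<in> borel_measurable borel" using K(1) by (rule borel_measurable_continuous_onI)
  note [measurable] = f(1) w(1)
  have "(\<integral>\<^sup>+x. ennreal (w x * norm (moll K f x - f x)) * indicator (cball 0 r) x \<partial>lborel)
     \<le> (\<integral>\<^sup>+x. (\<integral>\<^sup>+t. ennreal (K t) * (ennreal (w x * norm (f (x + t) - f x)) * indicator (cball 0 r) x) \<partial>lborel) \<partial>lborel)"
  proof (rule nn_integral_mono)
    fix x
    have "ennreal (w x * norm (moll K f x - f x)) * indicator (cball 0 r) x
       = (ennreal (w x) * indicator (cball 0 r) x) * ennreal (norm (moll K f x - f x))"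
      using w(2) by (simp add: ennreal_mult mult_ac)
    also have "\<dots> \<le> (ennreal (w x) * indicator (cball 0 r) x) * (\<integral>\<^sup>+t. ennreal (K t) * ennreal (norm (f (x + t) - f x)) \<partial>lborel)"
      by (intro mult_left_mono moll_diff_le[OF K f]) auto
    also have "\<dots> = (\<integral>\<^sup>+t. (ennreal (w x) * indicator (cball 0 r) x) * (ennreal (K t) * ennreal (norm (f (x + t) - f x))) \<partial>lborel)"
      by (rule nn_integral_cmult[symmetric]) simp
    also have "\<dots> = (\<integral>\<^sup>+t. ennreal (K t) * (ennreal (w x * norm (f (x + t) - f x)) * indicator (cball 0 r) x) \<partial>lborel)"
      using w(2) by (intro nn_integral_cong) (simp add: ennreal_mult mult_ac)
    finally show "ennreal (w x * norm (moll K f x - f x)) * indicator (cball 0 r) x \<le> \<dots>" .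
  qed
  also have "\<dots> = (\<integral>\<^sup>+t. (\<integral>\<^sup>+x. ennreal (K t) * (ennreal (w x * norm (f (x + t) - f x)) * indicator (cball 0 r) x) \<partial>lborel) \<partial>lborel)"
    by (rule lborel_pair.Fubini'[symmetric]) measurable
  also have "\<dots> = (\<integral>\<^sup>+t. ennreal (K t) * (\<integral>\<^sup>+x. ennreal (w x * norm (f (x + t) - f x)) * indicator (cball 0 r) x \<partial>lborel) \<partial>lborel)"
    by (intro nn_integral_cong nn_integral_cmult) measurable
  also have "\<dots> \<le> (\<integral>\<^sup>+t. ennreal (K t) * ennreal \<sigma> \<partial>lborel)"
  proof (rule nn_integral_mono)
    fix t
    show "ennreal (K t) * (\<integral>\<^sup>+x. ennreal (w x * norm (f (x + t) - f x)) * indicator (cball 0 r) x \<partial>lborel) \<le> ennreal (K t) * ennreal \<sigma>"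
    proof (cases "norm t \<le> \<epsilon>")
      case True
      then show ?thesis by (intro mult_left_mono le) auto
    next
      case False
      then show ?thesis using K(2)[of t] by simp
    qed
  qed
  also have "\<dots> = (\<integral>\<^sup>+t. ennreal (K t) \<partial>lborel) * ennreal \<sigma>" by (rule nn_integral_multc) measurable
  also have "(\<integral>\<^sup>+t. ennreal (K t) \<partial>lborel) = 1"
    using K by (subst nn_integral_eq_integral) auto
  finally show ?thesis by simp
qed

text \<open>The two topologies are those used in \<open>extended_test\<close>: plain L^1 on a ball
  for \<open>z\<close>, enough for an almost everywhere convergent subsequence, and weighted L^1 for
  the gradients. One kernel has to serve both, hence the minimum of the two scales; for
  \<open>z\<close> the weight is 1.\<close>

lemma smooth_approximation:
  fixes z :: "'a::euclidean_space \<Rightarrow> real" and G :: "'a \<Rightarrow> 'a" and w :: "'a \<Rightarrow> real"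
  assumes z: "loc_pow_int p z" and G: "loc_pow_int p G" and w: "loc_pow_int s w" "\<And>x. w x \<ge> 0"
    and ps: "1 < p" "1 < s" "1 / p + 1 / s = 1"
    and weak: "\<And>phi dphi e. test_fun phi dphi \<Longrightarrow>
       (\<integral>x. z x * (dphi x \<bullet> e) \<partial>lborel) = - (\<integral>x. (G x \<bullet> e) * phi x \<partial>lborel)"
    and \<sigma>: "\<sigma> > 0"
  obtains zs Gs where "\<And>x. (zs has_derivative (\<lambda>h. Gs x \<bullet> h)) (at x)" "continuous_on UNIV Gs"
    "(\<integral>\<^sup>+x. ennreal \<bar>zs x - z x\<bar> * indicator (cball 0 r) x \<partial>lborel) \<le> ennreal \<sigma>"
    "(\<integral>\<^sup>+x. ennreal (w x * norm (Gs x - G x)) * indicator (cball 0 r) x \<partial>lborel) \<le> ennreal \<sigma>"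
proof -
  have m[measurable]: "z \<in> borel_measurable borel" "G \<in> borel_measurable borel" "w \<in> borel_measurable borel"
    using z G w by (auto simp: loc_pow_int_def)
  have zi: "set_integrable lborel (cball 0 \<rho>) z" and Gi: "set_integrable lborel (cball 0 \<rho>) G" for \<rho>
    using loc_pow_int_set_integrable[OF z] loc_pow_int_set_integrable[OF G] ps by auto
  have one: "loc_pow_int s (\<lambda>x::'a. 1::real)"
    unfolding loc_pow_int_def using emeasure_cball_finite[where 'a='a] by simp
  obtain e1 where e1: "e1 > 0" "\<And>y. norm y \<le> e1 \<Longrightarrow>
      (\<integral>\<^sup>+x. ennreal (1 * norm (z (x + y) - z x)) * indicator (cball 0 r) x \<partial>lborel) \<le> ennreal \<sigma>"
    using translation_continuity[OF z one _ ps \<sigma>, of r] by auto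
  obtain e2 where e2: "e2 > 0" "\<And>y. norm y \<le> e2 \<Longrightarrow>
      (\<integral>\<^sup>+x. ennreal (w x * norm (G (x + y) - G x)) * indicator (cball 0 r) x \<partial>lborel) \<le> ennreal \<sigma>"
    using translation_continuity[OF G w(1) w(2) ps \<sigma>, of r] by auto
  have "min e1 e2 > 0" using e1 e2 by simp
  then obtain K dK where K: "test_fun (K :: 'a \<Rightarrow> real) dK" "\<And>x. K x \<ge> 0" "\<And>x. norm x > min e1 e2 \<Longrightarrow> K x = 0"
    "(\<integral>x. K x \<partial>lborel) = 1" "integrable lborel K"
    using mollifier_exists[where 'a='a] by blast
  note Kc = test_fun_continuous(1)[OF K(1)]
  show ?thesis
  proof (rule that[of "moll K z" "moll K G"])
    show "(moll K z has_derivative (\<bullet>) (moll K G x)) (at x)" for x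
      by (rule moll_has_derivative[OF K(1) m(1) zi m(2) Gi weak])
    show "continuous_on UNIV (moll K G)" by (rule moll_continuous[OF Kc K(3) m(2) Gi])
    show "(\<integral>\<^sup>+x. ennreal (w x * norm (moll K G x - G x)) * indicator (cball 0 r) x \<partial>lborel) \<le> ennreal \<sigma>"
      by (rule moll_weighted_diff_le[OF Kc K(3) K(2) K(4) K(5) m(2) Gi m(3) w(2)]) (use e2 in auto)
    have "(\<integral>\<^sup>+x. ennreal (1 * norm (moll K z x - z x)) * indicator (cball 0 r) x \<partial>lborel) \<le> ennreal \<sigma>"
      by (rule moll_weighted_diff_le[OF Kc K(3) K(2) K(4) K(5) m(1) zi]) (use e1 in auto)
    then show "(\<integral>\<^sup>+x. ennreal \<bar>moll K z x - z x\<bar> * indicator (cball 0 r) x \<partial>lborel) \<le> ennreal \<sigma>" by simp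
  qed
qed

lemma L1_cball_AE_subseq:
  fixes z :: "'a::euclidean_space \<Rightarrow> real"
  assumes m: "\<And>n. zs n \<in> borel_measurable borel" "z \<in> borel_measurable borel"
    and le: "\<And>n. (\<integral>\<^sup>+x. ennreal \<bar>zs n x - z x\<bar> * indicator (cball 0 r) x \<partial>lborel) \<le> ennreal (1 / real (Suc n))"
  obtains \<tau> where "strict_mono \<tau>" "AE x in lborel. norm x \<le> r \<longrightarrow> (\<lambda>n. zs (\<tau> n) x) \<longlonglongrightarrow> z x"
proof -
  note [measurable] = m
  define u where "u n x = indicator (cball 0 r) x * (zs n x - z x)" for n x
  have nn: "(\<integral>\<^sup>+x. ennreal (norm (u n x)) \<partial>lborel) \<le> ennreal (1 / real (Suc n))" for n
  proof -
    have "(\<integral>\<^sup>+x. ennreal (norm (u n x)) \<partial>lborel) = (\<integral>\<^sup>+x. ennreal \<bar>zs n x - z x\<bar> * indicator (cball 0 r) x \<partial>lborel)"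
      by (intro nn_integral_cong) (auto simp: u_def indicator_def)
    then show ?thesis using le[of n] by simp
  qed
  have [measurable]: "u n \<in> borel_measurable borel" for n unfolding u_def by measurable
  have i: "integrable lborel (u n)" for n
    using nn[of n] by (intro integrableI_bounded) (auto intro: le_less_trans)
  have "(\<integral>x. norm (u n x) \<partial>lborel) \<le> 1 / real (Suc n)" for n
  proof -
    have "ennreal (\<integral>x. norm (u n x) \<partial>lborel) = (\<integral>\<^sup>+x. ennreal (norm (u n x)) \<partial>lborel)"
      using i[of n] by (intro nn_integral_eq_integral[symmetric]) auto
    then have "ennreal (\<integral>x. norm (u n x) \<partial>lborel) \<le> ennreal (1 / real (Suc n))" using nn[of n] by simp
    then show ?thesis by (subst (asm) ennreal_le_iff) simp_all
  qed
  then have "(\<lambda>n. \<integral>x. norm (u n x) \<partial>lborel) \<longlonglongrightarrow> 0"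
    by (intro tendsto_sandwich[OF _ _ tendsto_const LIMSEQ_inverse_real_of_nat])
       (auto intro!: always_eventually simp: inverse_eq_divide simp del: of_nat_Suc)
  from tendsto_L1_AE_subseq[OF i this]
  obtain \<tau> where \<tau>: "strict_mono \<tau>" "AE x in lborel. (\<lambda>n. u (\<tau> n) x) \<longlonglongrightarrow> 0" by blast
  from \<tau>(2) have "AE x in lborel. norm x \<le> r \<longrightarrow> (\<lambda>n. zs (\<tau> n) x) \<longlonglongrightarrow> z x"
  proof (rule AE_mp, intro AE_I2 impI)
    fix x :: 'a assume "(\<lambda>n. u (\<tau> n) x) \<longlonglongrightarrow> 0" "norm x \<le> r"
    then have "(\<lambda>n. zs (\<tau> n) x - z x) \<longlonglongrightarrow> 0" by (simp add: u_def)
    then show "(\<lambda>n. zs (\<tau> n) x) \<longlonglongrightarrow> z x" by (rule LIM_zero_cancel)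
  qed
  then show ?thesis using \<tau>(1) that by blast
qed

section \<open>Testing the equation with a nonlinear function of the weakly differentiable
  \<open>z\<close>\<close>

text \<open>\<gamma>(z) phi is not C^1, so \<gamma>(zs n) phi with smooth zs n is tested and n sent
  to infinity. Conjugacy of \<open>p\<close> and \<open>s\<close> makes |F||G| locally integrable,
  and bounds on \<gamma> and \<gamma>' give a dominating function although \<open>g\<close> is
  merely in L^1.\<close>

lemma extended_test:
  fixes z g :: "'a::euclidean_space \<Rightarrow> real" and G F :: "'a \<Rightarrow> 'a"
  assumes z: "loc_pow_int p z" and G: "loc_pow_int p G" and F: "loc_pow_int s F" and g: "loc_pow_int 1 g"
    and ps: "1 < p" "1 < s" "1 / p + 1 / s = 1"
    and weak: "\<And>phi dphi e. test_fun phi dphi \<Longrightarrow>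
       (\<integral>x. z x * (dphi x \<bullet> e) \<partial>lborel) = - (\<integral>x. (G x \<bullet> e) * phi x \<partial>lborel)"
    and eqn: "\<And>phi dphi. test_fun phi dphi \<Longrightarrow> (\<integral>x. F x \<bullet> dphi x + g x * phi x \<partial>lborel) = 0"
    and \<gamma>: "\<And>t. (\<gamma> has_real_derivative \<gamma>' t) (at t)" "continuous_on UNIV \<gamma>'"
       "\<And>t. \<bar>\<gamma> t\<bar> \<le> M" "\<And>t. \<bar>\<gamma>' t\<bar> \<le> M"
    and phi: "test_fun phi dphi"
  defines "H \<equiv> \<lambda>x. \<gamma>' (z x) * phi x * (F x \<bullet> G x) + \<gamma> (z x) * (F x \<bullet> dphi x) + g x * (\<gamma> (z x) * phi x)"
  shows "integrable lborel H" "(\<integral>x. H x \<partial>lborel) = 0"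
proof -
  obtain r where r: "r > 0" "\<And>x. norm x > r \<Longrightarrow> phi x = 0" "\<And>x. norm x > r \<Longrightarrow> dphi x = 0"
    using test_fun_support[OF phi] by blast
  obtain B where B: "B > 0" "\<And>x. \<bar>phi x\<bar> \<le> B" "\<And>x. norm (dphi x) \<le> B"
    using test_fun_bounded[OF phi] by blast
  note phic = test_fun_continuous[OF phi]
  have \<gamma>c: "continuous_on UNIV \<gamma>"
    by (rule DERIV_continuous_on[where D = \<gamma>']) (use \<gamma>(1) has_field_derivative_at_within in blast)
  have M0: "M \<ge> 0" using \<gamma>(3)[of 0] by linarith
  have [measurable]: "z \<in> borel_measurable borel" "G \<in> borel_measurable borel" "F \<in> borel_measurable borel"
    "g \<in> borel_measurable borel" using z G F g by (auto simp: loc_pow_int_def)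
  have [measurable]: "phi \<in> borel_measurable borel" "dphi \<in> borel_measurable borel"
    "\<gamma> \<in> borel_measurable borel" "\<gamma>' \<in> borel_measurable borel"
    using phic \<gamma>c \<gamma>(2) by (auto intro: borel_measurable_continuous_onI)
  have gi: "set_integrable lborel (cball 0 r) g" by (rule loc_pow_int_set_integrable[OF g]) simp
  have Fi: "set_integrable lborel (cball 0 r) F" using ps by (intro loc_pow_int_set_integrable[OF F]) simp
  define w where "w x = norm (F x)" for x
  have w: "loc_pow_int s w" "\<And>x. w x \<ge> 0" using F by (auto simp: w_def[abs_def] loc_pow_int_def)
  have FGi: "set_integrable lborel (cball 0 r) (\<lambda>x. norm (F x) * norm (G x))"
  proof -
    have [measurable]: "w \<in> borel_measurable borel" unfolding w_def by measurable
    have Fs: "set_integrable lborel (cball 0 r) (\<lambda>x. norm (F x) powr s)"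
      using F ps by (intro loc_pow_int_set_integrable[of 1]) (auto simp: loc_pow_int_def)
    have Gs: "set_integrable lborel (cball 0 r) (\<lambda>x. norm (G x) powr p)"
      using G ps by (intro loc_pow_int_set_integrable[of 1]) (auto simp: loc_pow_int_def)
    have "set_integrable lborel (cball 0 r) (\<lambda>x. norm (F x) powr s + norm (G x) powr p)"
      using Fs Gs by (rule set_integral_add)
    then show ?thesis unfolding set_integrable_def
    proof (rule Bochner_Integration.integrable_bound)
      have "norm (F x) * norm (G x) \<le> norm (F x) powr s + norm (G x) powr p" for x
      proof -
        have "norm (F x) * norm (G x) \<le> norm (F x) powr s / s + norm (G x) powr p / p"
          using ps by (intro Youngs_inequality) auto
        also have "\<dots> \<le> norm (F x) powr s / 1 + norm (G x) powr p / 1"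
          using ps by (intro add_mono divide_left_mono) auto
        finally show ?thesis by simp
      qed
      then show "AE x in lborel. norm (indicat_real (cball 0 r) x *\<^sub>R (norm (F x) * norm (G x)))
          \<le> norm (indicat_real (cball 0 r) x *\<^sub>R (norm (F x) powr s + norm (G x) powr p))"
        by (intro AE_I2) (auto simp: indicator_def)
    qed measurable
  qed
  have bFG: "integrable lborel (\<lambda>x. c x * phi x * (F x \<bullet> G x))" if "c \<in> borel_measurable borel" "\<And>x. \<bar>c x\<bar> \<le> M" for c
  proof (rule integrable_loc_bound[OF _ FGi, where B = "M * B"])
    show "(\<lambda>x. c x * phi x * (F x \<bullet> G x)) \<in> borel_measurable borel" using that(1) by measurable
    fix x
    have "\<bar>c x\<bar> * \<bar>phi x\<bar> * \<bar>F x \<bullet> G x\<bar> \<le> M * B * (norm (F x) * norm (G x))"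
      using that(2) B M0 by (intro mult_mono Cauchy_Schwarz_ineq2) auto
    then show "norm (c x * phi x * (F x \<bullet> G x)) \<le> M * B * norm (norm (F x) * norm (G x))"
      by (simp add: abs_mult)
  qed (use r in auto)
  have bF: "integrable lborel (\<lambda>x. c x * (F x \<bullet> dphi x))" if "c \<in> borel_measurable borel" "\<And>x. \<bar>c x\<bar> \<le> M" for c
  proof (rule integrable_loc_bound[OF _ Fi, where B = "M * B"])
    show "(\<lambda>x. c x * (F x \<bullet> dphi x)) \<in> borel_measurable borel" using that(1) by measurable
    fix x
    have "\<bar>c x\<bar> * \<bar>F x \<bullet> dphi x\<bar> \<le> M * (norm (F x) * norm (dphi x))"
      using that(2) M0 by (intro mult_mono Cauchy_Schwarz_ineq2) auto
    also have "\<dots> \<le> M * (norm (F x) * B)" using B M0 by (intro mult_left_mono) auto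
    finally show "norm (c x * (F x \<bullet> dphi x)) \<le> M * B * norm (F x)" by (simp add: abs_mult mult_ac)
  qed (use r in auto)
  have bg: "integrable lborel (\<lambda>x. g x * (c x * phi x))" if "c \<in> borel_measurable borel" "\<And>x. \<bar>c x\<bar> \<le> M" for c
  proof (rule integrable_loc_bound[OF _ gi, where B = "M * B"])
    show "(\<lambda>x. g x * (c x * phi x)) \<in> borel_measurable borel" using that(1) by measurable
    fix x
    have "\<bar>g x\<bar> * (\<bar>c x\<bar> * \<bar>phi x\<bar>) \<le> \<bar>g x\<bar> * (M * B)"
      using that(2) B M0 by (intro mult_mono) auto
    then show "norm (g x * (c x * phi x)) \<le> M * B * norm (g x)" by (simp add: abs_mult mult_ac)
  qed (use r in auto)
  \<comment> \<open>Only the argument of \<gamma> and \<gamma>' varies; the gradient stays the true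
    \<open>G\<close>. This makes one dominating function valid for all \<open>n\<close>, the
    gradient error being collected separately in \<open>E\<close>.\<close>
  define J where "J y x = \<gamma>' (y x) * phi x * (F x \<bullet> G x) + \<gamma> (y x) * (F x \<bullet> dphi x) + g x * (\<gamma> (y x) * phi x)" for y x
  have Ji: "integrable lborel (J y)" if [measurable]: "y \<in> borel_measurable borel" for y
    unfolding J_def by (intro Bochner_Integration.integrable_add bFG bF bg \<gamma>(3,4)) measurable
  have JH: "J z = H" by (simp add: J_def[abs_def] H_def)
  show "integrable lborel H" using Ji[of z] JH by simp
  define Q where "Q n zs Gs \<longleftrightarrow> (\<forall>x. (zs has_derivative (\<lambda>h. Gs x \<bullet> h)) (at x)) \<and> continuous_on UNIV Gs \<and>
    (\<integral>\<^sup>+x. ennreal \<bar>zs x - z x\<bar> * indicator (cball 0 r) x \<partial>lborel) \<le> ennreal (1 / real (Suc n)) \<and>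
    (\<integral>\<^sup>+x. ennreal (w x * norm (Gs x - G x)) * indicator (cball 0 r) x \<partial>lborel) \<le> ennreal (1 / real (Suc n))"
    for n and zs and Gs :: "'a \<Rightarrow> 'a"
  have "\<exists>zs Gs. Q n zs Gs" for n
  proof -
    have "1 / real (Suc n) > 0" by simp
    show ?thesis
      by (rule smooth_approximation[OF z G w ps weak \<open>1 / real (Suc n) > 0\<close>, where r = r])
        (assumption | unfold Q_def, blast)+
  qed
  then obtain zs Gs where Q: "\<And>n. Q n (zs n) (Gs n)" by metis
  have zs: "\<And>n x. (zs n has_derivative (\<lambda>h. Gs n x \<bullet> h)) (at x)"
    and Gs: "\<And>n. continuous_on UNIV (Gs n)"
    and zle: "\<And>n. (\<integral>\<^sup>+x. ennreal \<bar>zs n x - z x\<bar> * indicator (cball 0 r) x \<partial>lborel) \<le> ennreal (1 / real (Suc n))"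
    and Gle: "\<And>n. (\<integral>\<^sup>+x. ennreal (w x * norm (Gs n x - G x)) * indicator (cball 0 r) x \<partial>lborel) \<le> ennreal (1 / real (Suc n))"
    using Q unfolding Q_def by blast+
  have zsc: "continuous_on UNIV (zs n)" for n
    by (rule has_derivative_continuous_on[where f' = "\<lambda>x h. Gs n x \<bullet> h"]) (use zs in simp)
  have [measurable]: "zs n \<in> borel_measurable borel" "Gs n \<in> borel_measurable borel" for n
    using zsc Gs by (auto intro: borel_measurable_continuous_onI)
  obtain \<tau> where \<tau>: "strict_mono \<tau>" "AE x in lborel. norm x \<le> r \<longrightarrow> (\<lambda>n. zs (\<tau> n) x) \<longlonglongrightarrow> z x"
    using L1_cball_AE_subseq[OF _ _ zle] by auto
  have conv: "(\<lambda>n. \<integral>x. J (zs (\<tau> n)) x \<partial>lborel) \<longlonglongrightarrow> (\<integral>x. J z x \<partial>lborel)"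
  proof (rule integral_dominated_convergence)
    show "J z \<in> borel_measurable lborel" using Ji[of z] by simp
    show "J (zs (\<tau> n)) \<in> borel_measurable lborel" for n using Ji[of "zs (\<tau> n)"] by simp
    let ?W = "\<lambda>x. M * norm (1 * phi x * (F x \<bullet> G x)) + M * norm (1 * (F x \<bullet> dphi x)) + M * norm (g x * (1 * phi x))"
    show "integrable lborel ?W"
    \<comment> \<open>\<open>bFG\<close>, \<open>bF\<close> and \<open>bg\<close> accept
      coefficients bounded by \<open>M\<close>. The coefficient 1 qualifies when M \<ge> 1;
      otherwise the constant \<open>M\<close> itself is used as coefficient.\<close>
    proof (cases "M \<ge> 1")
      case True
      then show ?thesis
        by (intro Bochner_Integration.integrable_add integrable_mult_right integrable_norm bFG bF bg) auto
    next
      case False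
      define c :: "'a \<Rightarrow> real" where "c = (\<lambda>_. M)"
      have "integrable lborel (\<lambda>x. norm (c x * phi x * (F x \<bullet> G x)) + norm (c x * (F x \<bullet> dphi x)) + norm (g x * (c x * phi x)))"
        using M0 by (intro Bochner_Integration.integrable_add integrable_norm bFG bF bg) (auto simp: c_def)
      then show ?thesis using M0 by (simp add: c_def abs_mult mult_ac)
    qed
    show "AE x in lborel. norm (J (zs (\<tau> n)) x) \<le> ?W x" for n
    proof (rule AE_I2)
      fix x
      have "norm (J (zs (\<tau> n)) x) \<le> \<bar>\<gamma>' (zs (\<tau> n) x)\<bar> * \<bar>phi x * (F x \<bullet> G x)\<bar> + \<bar>\<gamma> (zs (\<tau> n) x)\<bar> * \<bar>F x \<bullet> dphi x\<bar>
         + \<bar>\<gamma> (zs (\<tau> n) x)\<bar> * \<bar>g x * phi x\<bar>"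
        using abs_triangle_ineq[of "\<gamma>' (zs (\<tau> n) x) * phi x * (F x \<bullet> G x) + \<gamma> (zs (\<tau> n) x) * (F x \<bullet> dphi x)"
            "g x * (\<gamma> (zs (\<tau> n) x) * phi x)"]
          abs_triangle_ineq[of "\<gamma>' (zs (\<tau> n) x) * phi x * (F x \<bullet> G x)" "\<gamma> (zs (\<tau> n) x) * (F x \<bullet> dphi x)"]
        by (simp add: J_def abs_mult mult.assoc mult.left_commute)
      also have "\<dots> \<le> M * \<bar>phi x * (F x \<bullet> G x)\<bar> + M * \<bar>F x \<bullet> dphi x\<bar> + M * \<bar>g x * phi x\<bar>"
        by (intro add_mono mult_right_mono \<gamma>(3,4)) auto
      finally show "norm (J (zs (\<tau> n)) x) \<le> ?W x" by simp
    qed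
    show "AE x in lborel. (\<lambda>n. J (zs (\<tau> n)) x) \<longlonglongrightarrow> J z x"
      using \<tau>(2)
    proof (rule AE_mp, intro AE_I2 impI)
      fix x assume a: "norm x \<le> r \<longrightarrow> (\<lambda>n. zs (\<tau> n) x) \<longlonglongrightarrow> z x"
      show "(\<lambda>n. J (zs (\<tau> n)) x) \<longlonglongrightarrow> J z x"
      \<comment> \<open>Pointwise convergence is known only in the ball; outside it
        \<open>phi\<close> and \<open>dphi\<close> vanish, and \<open>J\<close> with them.\<close>
      proof (cases "norm x \<le> r")
        case True
        then have l: "(\<lambda>n. zs (\<tau> n) x) \<longlonglongrightarrow> z x" using a by simp
        have "isCont \<gamma> (z x)" "isCont \<gamma>' (z x)" using \<gamma>c \<gamma>(2) by (auto simp: continuous_on_eq_continuous_at)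
        then show ?thesis unfolding J_def by (intro tendsto_intros isCont_tendsto_compose[OF _ l])
      next
        case False
        then show ?thesis using r(2,3)[of x] by (simp add: J_def)
      qed
    qed
  qed
  \<comment> \<open>\<open>J (zs n) + E n\<close> is the integrand of the equation for the genuine
    test function \<gamma>(zs n) phi. The weight |F| in the approximation was chosen so that
    \<open>E n\<close> tends to 0 in L^1.\<close>
  define E where "E n x = \<gamma>' (zs n x) * phi x * (F x \<bullet> (Gs n x - G x))" for n x
  have zero: "integrable lborel (E n) \<and> (\<integral>x. J (zs n) x + E n x \<partial>lborel) = 0 \<and> \<bar>\<integral>x. E n x \<partial>lborel\<bar> \<le> M * B * (1 / real (Suc n))" for n
  proof (intro conjI)
    have mE[measurable]: "E n \<in> borel_measurable borel" unfolding E_def by measurable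
    have "(\<integral>\<^sup>+x. ennreal (norm (E n x)) \<partial>lborel)
       \<le> (\<integral>\<^sup>+x. ennreal (M * B) * (ennreal (w x * norm (Gs n x - G x)) * indicator (cball 0 r) x) \<partial>lborel)"
    proof (rule nn_integral_mono)
      fix x
      show "ennreal (norm (E n x)) \<le> ennreal (M * B) * (ennreal (w x * norm (Gs n x - G x)) * indicator (cball 0 r) x)"
      proof (cases "norm x \<le> r")
        case True
        have "\<bar>\<gamma>' (zs n x)\<bar> * \<bar>phi x\<bar> * \<bar>F x \<bullet> (Gs n x - G x)\<bar> \<le> M * B * (norm (F x) * norm (Gs n x - G x))"
          using \<gamma>(4) B M0 by (intro mult_mono Cauchy_Schwarz_ineq2) auto
        then have "norm (E n x) \<le> M * B * (w x * norm (Gs n x - G x))" by (simp add: E_def w_def abs_mult)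
        then have "ennreal (norm (E n x)) \<le> ennreal (M * B * (w x * norm (Gs n x - G x)))" by (rule ennreal_leI)
        also have "\<dots> = ennreal (M * B) * ennreal (w x * norm (Gs n x - G x))"
          using M0 B(1) w(2) by (intro ennreal_mult) auto
        finally show ?thesis using True by simp
      next
        case False
        then show ?thesis using r(2)[of x] by (simp add: E_def)
      qed
    qed
    also have "\<dots> = ennreal (M * B) * (\<integral>\<^sup>+x. ennreal (w x * norm (Gs n x - G x)) * indicator (cball 0 r) x \<partial>lborel)"
      unfolding w_def by (rule nn_integral_cmult) measurable
    also have "\<dots> \<le> ennreal (M * B) * ennreal (1 / real (Suc n))" by (intro mult_left_mono Gle) auto
    also have "\<dots> = ennreal (M * B * (1 / real (Suc n)))" using M0 B by (intro ennreal_mult[symmetric]) auto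
    finally have nn: "(\<integral>\<^sup>+x. ennreal (norm (E n x)) \<partial>lborel) \<le> ennreal (M * B * (1 / real (Suc n)))" .
    show Ei: "integrable lborel (E n)"
      by (rule integrableI_bounded) (use nn in \<open>auto intro: le_less_trans\<close>)
    have "ennreal (norm (\<integral>x. E n x \<partial>lborel)) \<le> ennreal (M * B * (1 / real (Suc n)))"
      using integral_norm_bound_ennreal[OF Ei] nn by (rule order_trans)
    then show "\<bar>\<integral>x. E n x \<partial>lborel\<bar> \<le> M * B * (1 / real (Suc n))" using M0 B by (simp del: of_nat_Suc)
    have t: "test_fun (\<lambda>x. \<gamma> (zs n x) * phi x) (\<lambda>x. phi x *\<^sub>R (\<gamma>' (zs n x) *\<^sub>R Gs n x) + \<gamma> (zs n x) *\<^sub>R dphi x)"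
    proof (rule test_fun_mult_left[OF phi])
      fix x
      have "(\<gamma> has_derivative (\<lambda>h. \<gamma>' (zs n x) * h)) (at (zs n x))"
        using \<gamma>(1)[of "zs n x"] by (simp add: has_field_derivative_def)
      from has_derivative_compose[OF zs this]
      show "((\<lambda>x. \<gamma> (zs n x)) has_derivative (\<bullet>) (\<gamma>' (zs n x) *\<^sub>R Gs n x)) (at x)"
        by (rule has_derivative_eq_rhs) (simp add: fun_eq_iff)
    next
      have "continuous_on UNIV (\<lambda>x. \<gamma>' (zs n x))" by (rule continuous_on_compose2[OF \<gamma>(2) zsc subset_UNIV])
      then show "continuous_on UNIV (\<lambda>x. \<gamma>' (zs n x) *\<^sub>R Gs n x)" using Gs by (intro continuous_intros)
    qed
    have "J (zs n) x + E n x = F x \<bullet> (phi x *\<^sub>R (\<gamma>' (zs n x) *\<^sub>R Gs n x) + \<gamma> (zs n x) *\<^sub>R dphi x) + g x * (\<gamma> (zs n x) * phi x)" for x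
      by (simp add: J_def E_def inner_add_right inner_diff_right algebra_simps)
    then show "(\<integral>x. J (zs n) x + E n x \<partial>lborel) = 0" using eqn[OF t] by simp
  qed
  have "(\<lambda>n. \<integral>x. J (zs (\<tau> n)) x \<partial>lborel) \<longlonglongrightarrow> 0"
  proof (rule Lim_null_comparison)
    show "\<forall>\<^sub>F n in sequentially. norm (\<integral>x. J (zs (\<tau> n)) x \<partial>lborel) \<le> M * B * (1 / real (Suc (\<tau> n)))"
    proof (rule always_eventually, rule allI)
      fix n
      have "(\<integral>x. J (zs (\<tau> n)) x \<partial>lborel) + (\<integral>x. E (\<tau> n) x \<partial>lborel) = 0"
        using zero[of "\<tau> n"] Bochner_Integration.integral_add[OF Ji[of "zs (\<tau> n)"], of "E (\<tau> n)"] by simp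
      then have "(\<integral>x. J (zs (\<tau> n)) x \<partial>lborel) = - (\<integral>x. E (\<tau> n) x \<partial>lborel)" by linarith
      then show "norm (\<integral>x. J (zs (\<tau> n)) x \<partial>lborel) \<le> M * B * (1 / real (Suc (\<tau> n)))"
        using zero[of "\<tau> n"] by simp
    qed
    have "(\<lambda>n. 1 / real (Suc n)) \<longlonglongrightarrow> 0"
      using LIMSEQ_inverse_real_of_nat by (simp add: inverse_eq_divide)
    from LIMSEQ_subseq_LIMSEQ[OF this \<tau>(1)]
    have "(\<lambda>n. M * B * (1 / real (Suc (\<tau> n)))) \<longlonglongrightarrow> M * B * 0" by (intro tendsto_intros) (simp add: o_def)
    then show "(\<lambda>n. M * B * (1 / real (Suc (\<tau> n)))) \<longlonglongrightarrow> 0" by simp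
  qed
  from LIMSEQ_unique[OF conv this] show "(\<integral>x. H x \<partial>lborel) = 0" using JH by simp
qed

section \<open>The saturating test function\<close>

text \<open>The test function must be bounded, since only \<open>|u|^q\<close> and \<open>|v|^q\<close> are locally integrable, but its
  derivative \<open>~ |t|^(-1-ab)\<close> at infinity must decay slowly: \<open>ab\<close> small and \<open>a\<close> large give
  the growth condition of \<open>sat_growth\<close> with \<open>\<theta>\<close> arbitrarily close to 1.\<close>

definition sat :: "real \<Rightarrow> real \<Rightarrow> real \<Rightarrow> real" where
  "sat a b t = sgn t * (1 - (1 + \<bar>t\<bar> powr a) powr (- b))"

definition dsat :: "real \<Rightarrow> real \<Rightarrow> real \<Rightarrow> real" where
  "dsat a b t = a * b * \<bar>t\<bar> powr (a - 1) * (1 + \<bar>t\<bar> powr a) powr (- b - 1)"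

lemma one_minus_powr_le:
  fixes s b :: real
  assumes "s \<ge> 0" "b \<ge> 0"
  shows "1 - (1 + s) powr (- b) \<le> b * s"
proof -
  have "b * ln (1 + s) \<le> b * s" using assms ln_add_one_self_le_self[of s] by (intro mult_left_mono) auto
  moreover have "1 + (- b) * ln (1 + s) \<le> exp ((- b) * ln (1 + s))" by (rule exp_ge_add_one_self)
  moreover have "(1 + s) powr (- b) = exp ((- b) * ln (1 + s))" using assms by (simp add: powr_def)
  ultimately show ?thesis by simp
qed

lemma abs_sat:
  assumes "b > 0"
  shows "\<bar>sat a b t\<bar> = (if t = 0 then 0 else 1 - (1 + \<bar>t\<bar> powr a) powr (- b))"
proof -
  have "(1 + \<bar>t\<bar> powr a) powr (- b) \<le> 1 powr (- b)" using assms by (intro powr_mono2') auto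
  then show ?thesis by (auto simp: sat_def abs_mult sgn_if)
qed

lemma abs_sat_le_1: "b > 0 \<Longrightarrow> \<bar>sat a b t\<bar> \<le> 1"
  by (simp add: abs_sat)

lemma abs_sat_pos:
  assumes "b > 0" "t \<noteq> 0"
  shows "\<bar>sat a b t\<bar> > 0"
proof -
  have "(1 + \<bar>t\<bar> powr a) powr (- b) < 1 powr (- b)" using assms by (intro powr_less_mono2_neg) auto
  then show ?thesis using assms by (simp add: abs_sat)
qed

lemma abs_sat_le:
  assumes "b > 0"
  shows "\<bar>sat a b t\<bar> \<le> b * \<bar>t\<bar> powr a"
  using one_minus_powr_le[of "\<bar>t\<bar> powr a" b] assms by (simp add: abs_sat)

lemma dsat_nonneg: "a > 0 \<Longrightarrow> b > 0 \<Longrightarrow> dsat a b t \<ge> 0"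
  by (simp add: dsat_def)

lemma dsat_le:
  assumes "a > 1" "b > 0"
  shows "\<bar>dsat a b t\<bar> \<le> a * b"
proof -
  let ?u = "1 + \<bar>t\<bar> powr a"
  have "\<bar>t\<bar> powr (a - 1) \<le> ?u"
  proof (cases "\<bar>t\<bar> \<le> 1")
    case True
    then have "\<bar>t\<bar> powr (a - 1) \<le> 1 powr (a - 1)" using assms by (intro powr_mono2) auto
    then show ?thesis by (simp add: add_increasing2)
  next
    case False
    then have "\<bar>t\<bar> powr (a - 1) \<le> \<bar>t\<bar> powr a" by (intro powr_mono) auto
    then show ?thesis by simp
  qed
  then have "\<bar>t\<bar> powr (a - 1) * ?u powr (- b - 1) \<le> ?u * ?u powr (- b - 1)" by (intro mult_right_mono) auto
  also have "\<dots> = ?u powr 1 * ?u powr (- b - 1)" by (simp add: add_nonneg_pos)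
  also have "\<dots> = ?u powr (- b)" unfolding powr_add[symmetric] by simp
  also have "\<dots> \<le> 1 powr (- b)" using assms by (intro powr_mono2') auto
  finally have "a * b * (\<bar>t\<bar> powr (a - 1) * ?u powr (- b - 1)) \<le> a * b * 1"
    using assms by (intro mult_left_mono) auto
  then show ?thesis using dsat_nonneg[of a b t] assms by (simp add: dsat_def mult_ac)
qed

lemma continuous_dsat:
  assumes "a > 1"
  shows "continuous_on UNIV (dsat a b)"
proof -
  have c: "continuous_on UNIV (\<lambda>t::real. \<bar>t\<bar> powr c)" if "c > 0" for c
    using that by (intro continuous_on_powr' continuous_intros) auto
  have "1 + \<bar>t\<bar> powr a \<noteq> 0" for t :: real by (smt (verit) powr_ge_zero)
  then have "continuous_on UNIV (\<lambda>t::real. (1 + \<bar>t\<bar> powr a) powr (- b - 1))"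
    by (intro continuous_on_powr[OF continuous_on_add[OF continuous_on_const c] continuous_on_const])
       (use assms in auto)
  then show ?thesis unfolding dsat_def[abs_def]
    using assms c[of "a - 1"] by (intro continuous_on_mult continuous_on_const) auto
qed

lemma sat_has_derivative_pos:
  assumes "t > 0"
  shows "(sat a b has_real_derivative dsat a b t) (at t)"
proof -
  have p: "1 + t powr a > 0" by (simp add: add_pos_nonneg)
  have "((\<lambda>t. 1 - (1 + t powr a) powr (- b)) has_real_derivative
      - ((1 + t powr a) powr (- b) * ((0) * ln (1 + t powr a) + (a * t powr (a - 1)) * (- b) / (1 + t powr a)))) (at t)"
    using assms p by (auto intro!: derivative_eq_intros simp: powr_diff mult_ac)
  also have "- ((1 + t powr a) powr (- b) * ((0) * ln (1 + t powr a) + (a * t powr (a - 1)) * (- b) / (1 + t powr a)))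
     = dsat a b t"
    using assms p by (simp add: dsat_def powr_diff[of _ "- b" 1])
  finally show ?thesis
  proof (rule DERIV_cong_ev[THEN iffD1, OF refl _ refl, rotated])
    show "\<forall>\<^sub>F x in nhds t. 1 - (1 + x powr a) powr - b = sat a b x"
      using eventually_nhds_in_open[of "{0<..}" t] assms by (auto elim!: eventually_mono simp: sat_def)
  qed
qed

text \<open>Oddness reduces negative arguments to positive ones. At 0 the difference quotient is at
  most b |h|^(a-1), so a > 1 gives derivative 0.\<close>

lemma sat_has_derivative:
  assumes "a > 1" "b > 0"
  shows "(sat a b has_real_derivative dsat a b t) (at t)"
proof -
  consider "t > 0" | "t < 0" | "t = 0" by linarith
  then show ?thesis
  proof cases
    case 1 then show ?thesis by (rule sat_has_derivative_pos)
  next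
    case 2
    then have "(sat a b has_real_derivative dsat a b (- t)) (at (- t))" by (intro sat_has_derivative_pos) simp
    then have "((\<lambda>x. sat a b (- x)) has_real_derivative - dsat a b (- t)) (at t)" by (simp add: DERIV_mirror)
    from DERIV_minus[OF this] show ?thesis by (simp add: sat_def[abs_def] dsat_def sgn_minus)
  next
    case 3
    have "((\<lambda>h. sat a b h / h) \<longlongrightarrow> 0) (at 0)"
    proof (rule Lim_null_comparison)
      show "\<forall>\<^sub>F h in at 0. norm (sat a b h / h) \<le> b * \<bar>h\<bar> powr (a - 1)"
        unfolding eventually_at_filter
      proof (intro always_eventually allI impI)
        fix h :: real assume h: "h \<noteq> 0"
        have "norm (sat a b h / h) = \<bar>sat a b h\<bar> / \<bar>h\<bar>" by simp
        also have "\<dots> \<le> b * \<bar>h\<bar> powr a / \<bar>h\<bar>" using abs_sat_le[OF assms(2)] by (intro divide_right_mono) auto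
        also have "\<dots> = b * \<bar>h\<bar> powr (a - 1)" using h by (simp add: powr_diff)
        finally show "norm (sat a b h / h) \<le> b * \<bar>h\<bar> powr (a - 1)" .
      qed
      have "((\<lambda>h. b * \<bar>h\<bar> powr (a - 1)) \<longlongrightarrow> b * \<bar>0\<bar> powr (a - 1)) (at (0::real))"
        using assms by (intro tendsto_intros tendsto_powr') auto
      then show "((\<lambda>h. b * \<bar>h\<bar> powr (a - 1)) \<longlongrightarrow> 0) (at (0::real))" by simp
    qed
    then show ?thesis using 3 assms by (simp add: DERIV_def sat_def dsat_def)
  qed
qed

text \<open>Write \<gamma> for \<open>sat a b\<close>. Near 0, |\<gamma>| ~ b|t|^a and \<gamma>' ~
  |t|^(a-1); comparing powers asks for p-1+a(1-\<theta>) \<ge> q\<theta>, which a(1-\<theta>) = q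
  ensures. At infinity |\<gamma>| tends to 1 and \<gamma>' ~ |t|^(-1-ab); ab = q\<theta>-1 leaves
  the exponent q\<theta>(2-p) \<ge> 0 on the right. The condition q\<theta> > 1 is the positivity of
  \<open>b\<close>.\<close>

lemma sat_growth:
  assumes p: "1 < p" "p \<le> 2" and th: "0 < \<theta>" "\<theta> < 1" "q * \<theta> > 1" "q > 1"
    and a: "a = q / (1 - \<theta>)" and b: "b = (q * \<theta> - 1) / a"
  obtains C where "C > 0"
    "\<And>t. \<bar>sat a b t\<bar> powr p \<le> C * dsat a b t powr (p - 1) * (\<bar>t\<bar> powr q * \<bar>sat a b t\<bar>) powr \<theta>"
proof -
  have a1: "a > 1" using th unfolding a by (simp add: less_divide_eq)
  have b0: "b > 0" using b a1 th by simp
  have ab: "a * b = q * \<theta> - 1" using a1 b by simp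
  have aq: "a * (1 - \<theta>) = q" using a th by simp
  \<comment> \<open>1+s^a is at most 2 for s \<le> 1 and at most 2s^a for s \<ge> 1, so
    \<open>dsat\<close> is at least c s^(a-1), respectively c s^(-1-ab).\<close>
  define c where "c = a * b * 2 powr (- b - 1)"
  have c0: "c > 0" using a1 b0 by (simp add: c_def)
  define C where "C = (1 + b powr (p - \<theta>)) / c powr (p - 1)"
  have C0: "C > 0" using c0 by (simp add: C_def add_pos_nonneg)
  have Cc: "C * c powr (p - 1) = 1 + b powr (p - \<theta>)" using c0 by (simp add: C_def)
  \<comment> \<open>The claim with a factor |\<gamma>|^\<theta> divided out; p > 1 > \<theta> keeps
    the remaining exponent positive.\<close>
  have main: "\<bar>sat a b t\<bar> powr (p - \<theta>) \<le> C * dsat a b t powr (p - 1) * (\<bar>t\<bar> powr q) powr \<theta>" if t: "t \<noteq> 0" for t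
  proof -
    define s where "s = \<bar>t\<bar>"
    have s: "s > 0" using t by (simp add: s_def)
    have "1 + b powr (p - \<theta>) \<ge> 1" by simp
    show ?thesis
    proof (cases "s \<le> 1")
      case True
      have "\<bar>sat a b t\<bar> powr (p - \<theta>) \<le> (b * s powr a) powr (p - \<theta>)"
        using abs_sat_le[OF b0, of a t] p th by (intro powr_mono2) (auto simp: s_def)
      also have "\<dots> = b powr (p - \<theta>) * s powr (a * (p - \<theta>))" using b0 by (simp add: powr_mult powr_powr)
      also have "\<dots> \<le> (1 + b powr (p - \<theta>)) * s powr ((a - 1) * (p - 1) + q * \<theta>)"
      proof (intro mult_mono powr_mono')
        have "a * (p - \<theta>) = (a - 1) * (p - 1) + (p - 1) + a * (1 - \<theta>)" by (simp add: algebra_simps)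
        moreover have "q * \<theta> \<le> q" using th by simp
        ultimately show "(a - 1) * (p - 1) + q * \<theta> \<le> a * (p - \<theta>)" using aq p by linarith
      qed (use s True in auto)
      also have "\<dots> = C * (c * s powr (a - 1)) powr (p - 1) * (s powr q) powr \<theta>"
        unfolding Cc[symmetric] using c0 by (simp add: powr_mult powr_powr powr_add mult_ac)
      also have "\<dots> \<le> C * dsat a b t powr (p - 1) * (s powr q) powr \<theta>"
      proof (intro mult_right_mono mult_left_mono powr_mono2)
        have "s powr a \<le> 1 powr a" using True s a1 by (intro powr_mono2) auto
        then have "2 powr (- b - 1) \<le> (1 + s powr a) powr (- b - 1)"
          using b0 by (intro powr_mono2') (auto simp: add_pos_nonneg)
        then have "a * b * s powr (a - 1) * 2 powr (- b - 1) \<le> a * b * s powr (a - 1) * (1 + s powr a) powr (- b - 1)"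
          using a1 b0 by (intro mult_left_mono) auto
        then show "c * s powr (a - 1) \<le> dsat a b t" by (simp add: c_def dsat_def s_def mult_ac)
      qed (use c0 C0 p in auto)
      finally show ?thesis by (simp add: s_def)
    next
      case False
      then have s1: "s \<ge> 1" by simp
      have "\<bar>sat a b t\<bar> powr (p - \<theta>) \<le> 1 powr (p - \<theta>)"
        using abs_sat_le_1[OF b0, of a t] p th by (intro powr_mono2) auto
      also have "\<dots> \<le> (1 + b powr (p - \<theta>)) * s powr ((- 1 - a * b) * (p - 1) + q * \<theta>)"
      proof -
        have "q * \<theta> * (p - 1) \<le> q * \<theta> * 1" using p th by (intro mult_left_mono) auto
        then have "(- 1 - a * b) * (p - 1) + q * \<theta> \<ge> 0" unfolding ab by (simp add: algebra_simps)
        then have "1 * 1 \<le> (1 + b powr (p - \<theta>)) * s powr ((- 1 - a * b) * (p - 1) + q * \<theta>)"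
          using s1 by (intro mult_mono ge_one_powr_ge_zero) auto
        then show ?thesis by simp
      qed
      also have "\<dots> = C * (c * s powr (- 1 - a * b)) powr (p - 1) * (s powr q) powr \<theta>"
        unfolding Cc[symmetric] using c0 by (simp add: powr_mult powr_powr powr_add mult_ac)
      also have "\<dots> \<le> C * dsat a b t powr (p - 1) * (s powr q) powr \<theta>"
      proof (intro mult_right_mono mult_left_mono powr_mono2)
        have "1 \<le> s powr a" using s1 a1 by (intro ge_one_powr_ge_zero) auto
        then have "(2 * s powr a) powr (- b - 1) \<le> (1 + s powr a) powr (- b - 1)"
          using b0 by (intro powr_mono2') (auto simp: add_pos_nonneg)
        then have "a * b * s powr (a - 1) * (2 * s powr a) powr (- b - 1) \<le> a * b * s powr (a - 1) * (1 + s powr a) powr (- b - 1)"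
          using a1 b0 by (intro mult_left_mono) auto
        also have "s powr (a - 1) * s powr (a * (- b - 1)) = s powr (- 1 - a * b)"
          unfolding powr_add[symmetric] by (simp add: algebra_simps)
        then have "a * b * s powr (a - 1) * (2 * s powr a) powr (- b - 1) = c * s powr (- 1 - a * b)"
          by (simp add: c_def powr_mult powr_powr)
        finally show "c * s powr (- 1 - a * b) \<le> dsat a b t" by (simp add: dsat_def s_def)
      qed (use c0 C0 p in auto)
      finally show ?thesis by (simp add: s_def)
    qed
  qed
  show ?thesis
  proof (rule that[OF C0])
    fix t
    show "\<bar>sat a b t\<bar> powr p \<le> C * dsat a b t powr (p - 1) * (\<bar>t\<bar> powr q * \<bar>sat a b t\<bar>) powr \<theta>"
    proof (cases "t = 0")
      case False
      have "\<bar>sat a b t\<bar> powr p = \<bar>sat a b t\<bar> powr (p - \<theta>) * \<bar>sat a b t\<bar> powr \<theta>"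
        unfolding powr_add[symmetric] by simp
      also have "\<dots> \<le> (C * dsat a b t powr (p - 1) * (\<bar>t\<bar> powr q) powr \<theta>) * \<bar>sat a b t\<bar> powr \<theta>"
        by (intro mult_right_mono main False) auto
      finally show ?thesis by (simp add: powr_mult mult_ac)
    qed (simp add: sat_def)
  qed
qed

text \<open>Young's inequality with the exponents \<open>(p-1)/p\<close>, \<open>\<theta>/p\<close>, \<open>(1-\<theta>)/p\<close>; here \<open>m ^ k\<close> is the value
  of the cutoff and \<open>D * m ^ (k - 1)\<close> bounds its gradient.\<close>

lemma absorb_flux_term:
  assumes p: "1 < p" and th: "0 < \<theta>" "\<theta> < 1" and k: "real k * (1 - \<theta>) \<ge> p" "k \<ge> 2" and e: "e > 0" and C: "C > 0"
  obtains C' where "C' > 0"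
    "\<And>f g g' y m D. f \<ge> 0 \<Longrightarrow> g \<ge> 0 \<Longrightarrow> g' \<ge> 0 \<Longrightarrow> y \<ge> 0 \<Longrightarrow> 0 \<le> m \<Longrightarrow> m \<le> 1 \<Longrightarrow> D \<ge> 0 \<Longrightarrow>
       g powr p \<le> C * g' powr (p - 1) * (y * g) powr \<theta> \<Longrightarrow>
       f * g * (D * m ^ (k - 1)) \<le> e * (m ^ k * g' * f powr (p / (p - 1))) + e * (m ^ k * (y * g)) + C' * D powr (p / (1 - \<theta>))"
proof -
  define \<alpha> where "\<alpha> = (p - 1) / p"
  define \<beta> where "\<beta> = \<theta> / p"
  define \<delta> where "\<delta> = (1 - \<theta>) / p"
  have abd: "\<alpha> > 0" "\<beta> > 0" "\<delta> > 0" "\<alpha> + \<beta> + \<delta> = 1" using p th by (auto simp: \<alpha>_def \<beta>_def \<delta>_def field_simps)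
  \<comment> \<open>C'^\<delta> supplies C^(1/p) and cancels the e^(\<alpha>+\<beta>) that appears
    when \<open>e\<close> is attached to the first two factors.\<close>
  define C' where "C' = (C powr (1 / p) * e powr (- (\<alpha> + \<beta>))) powr (1 / \<delta>)"
  have C'0: "C' > 0" using C e by (simp add: C'_def)
  have C'\<delta>: "C' powr \<delta> = C powr (1 / p) * e powr (- (\<alpha> + \<beta>))" using abd C e by (simp add: C'_def powr_powr)
  show ?thesis
  proof (rule that[OF C'0])
    fix f g g' y m D :: real
    assume nn: "f \<ge> 0" "g \<ge> 0" "g' \<ge> 0" "y \<ge> 0" "0 \<le> m" "m \<le> 1" "D \<ge> 0"
      and gr: "g powr p \<le> C * g' powr (p - 1) * (y * g) powr \<theta>"
    show "f * g * (D * m ^ (k - 1)) \<le> e * (m ^ k * g' * f powr (p / (p - 1))) + e * (m ^ k * (y * g)) + C' * D powr (p / (1 - \<theta>))"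
    \<comment> \<open>For m = 0 the left side vanishes because k-1 \<ge> 1; converting powers of
      \<open>m\<close> to real exponents below requires m > 0.\<close>
    proof (cases "m = 0")
      case True
      then show ?thesis using k(2) C'0 by (simp add: power_0_left)
    next
      case False
      then have m: "m > 0" using nn by simp
      have "g = (g powr p) powr (1 / p)" using nn p by (simp add: powr_powr)
      also have "\<dots> \<le> (C * g' powr (p - 1) * (y * g) powr \<theta>) powr (1 / p)"
        using gr p by (intro powr_mono2) auto
      also have "\<dots> = C powr (1 / p) * g' powr \<alpha> * (y * g) powr \<beta>"
        by (simp add: powr_mult powr_powr \<alpha>_def \<beta>_def)
      finally have g: "g \<le> C powr (1 / p) * g' powr \<alpha> * (y * g) powr \<beta>" .
      \<comment> \<open>The hypothesis on \<open>k\<close> says k\<delta> \<ge> 1, so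
        k(\<alpha>+\<beta>) = k - k\<delta> \<le> k - 1, and for m \<le> 1 the smaller exponent
        gives the larger power.\<close>
      have "m ^ (k - 1) = m powr (real k - 1)" using m k(2) by (simp add: powr_realpow[symmetric] of_nat_diff)
      also have "\<dots> \<le> m powr (real k * (\<alpha> + \<beta>))"
      proof (rule powr_mono')
        have "real k * \<delta> \<ge> 1" using k p by (simp add: \<delta>_def field_simps)
        moreover have "\<alpha> + \<beta> = 1 - \<delta>" using abd(4) by simp
        ultimately show "real k * (\<alpha> + \<beta>) \<le> real k - 1" by (simp add: right_diff_distrib)
      qed (use nn in auto)
      also have "\<dots> = (m ^ k) powr (\<alpha> + \<beta>)" using m by (simp add: powr_realpow[symmetric] powr_powr)
      finally have mk: "m ^ (k - 1) \<le> (m ^ k) powr (\<alpha> + \<beta>)" .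
      have e1: "e powr (\<alpha> + \<beta>) * e powr (- (\<alpha> + \<beta>)) = 1" using e by (simp flip: powr_add)
      have "f * g * (D * m ^ (k - 1)) \<le> f * (C powr (1 / p) * g' powr \<alpha> * (y * g) powr \<beta>) * (D * (m ^ k) powr (\<alpha> + \<beta>))"
        using nn mk g by (intro mult_mono) auto
      also have "\<dots> = f * (C powr (1 / p) * g' powr \<alpha> * (y * g) powr \<beta>) * (D * (m ^ k) powr (\<alpha> + \<beta>)) * (e powr (\<alpha> + \<beta>) * e powr (- (\<alpha> + \<beta>)))"
        by (simp only: e1 mult_1_right)
      also have "\<dots> = (e * (m ^ k * g' * f powr (p / (p - 1)))) powr \<alpha> * (e * (m ^ k * (y * g))) powr \<beta> * (C' * D powr (p / (1 - \<theta>))) powr \<delta>"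
      proof -
        have "(f powr (p / (p - 1))) powr \<alpha> = f" using nn p by (simp add: powr_powr \<alpha>_def)
        moreover have "(D powr (p / (1 - \<theta>))) powr \<delta> = D" using nn p th by (simp add: powr_powr \<delta>_def)
        ultimately show ?thesis using C'\<delta> by (simp add: powr_mult powr_add mult_ac)
      qed
      also have "\<dots> \<le> e * (m ^ k * g' * f powr (p / (p - 1))) + e * (m ^ k * (y * g)) + C' * D powr (p / (1 - \<theta>))"
        using nn e C'0 abd by (intro prod3_le_sum_powr) auto
      finally show ?thesis .
    qed
  qed
qed

section \<open>The Liouville property\<close>

text \<open>Retains from the system only a divergence equation and two coercivity inequalities.
  Tested with \<open>sat a b (z x)\<close> times a cutoff, the coercive terms absorb the flux term
  up to a constant times R^(N-r), with r > N.\<close>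

lemma absorption_liouville:
  fixes z g :: "'a::euclidean_space \<Rightarrow> real" and G F :: "'a \<Rightarrow> 'a"
  assumes pq: "1 < p" "p \<le> 2" "q > 1"
    and z: "loc_pow_int p z" and G: "loc_pow_int p G" and F: "loc_pow_int (p / (p - 1)) F" and g: "loc_pow_int 1 g"
    and weak: "\<And>phi dphi e. test_fun phi dphi \<Longrightarrow>
       (\<integral>x. z x * (dphi x \<bullet> e) \<partial>lborel) = - (\<integral>x. (G x \<bullet> e) * phi x \<partial>lborel)"
    and eqn: "\<And>phi dphi. test_fun phi dphi \<Longrightarrow> (\<integral>x. F x \<bullet> dphi x + g x * phi x \<partial>lborel) = 0"
    and FG: "c1 > 0" "\<And>x. F x \<bullet> G x \<ge> c1 * norm (F x) powr (p / (p - 1))"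
    and gz: "c2 > 0" "\<And>x. g x * z x \<ge> c2 * \<bar>z x\<bar> powr (q + 1)"
  shows "AE x in lborel. z x = 0"
proof -
  define N where "N = DIM('a)"
  have N: "real N \<ge> 1" using DIM_positive[where 'a='a] unfolding N_def by linarith
  \<comment> \<open>The first bound gives q\<eta> \<le> (q-1)/2, hence q\<theta> > 1; the second
    gives N\<eta> \<le> 1/2 < p, hence N < r.\<close>
  define \<eta> where "\<eta> = min ((q - 1) / (2 * q)) (1 / (2 * real N))"
  define \<theta> where "\<theta> = 1 - \<eta>"
  have "1 / (2 * real N) \<le> 1 / 2" using N by (simp add: field_simps)
  moreover have "\<eta> \<le> 1 / (2 * real N)" by (simp add: \<eta>_def)
  ultimately have "\<eta> \<le> 1 / 2" by linarith
  moreover have "\<eta> > 0" using pq N by (auto simp: \<eta>_def)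
  ultimately have eta: "\<eta> > 0" "\<eta> \<le> 1 / 2" by auto
  have "q * \<eta> \<le> q * ((q - 1) / (2 * q))" using pq by (intro mult_left_mono) (auto simp: \<eta>_def)
  also have "\<dots> = (q - 1) / 2" using pq by simp
  finally have "q * \<theta> > 1" using pq by (simp add: \<theta>_def algebra_simps)
  then have th: "0 < \<theta>" "\<theta> < 1" "q * \<theta> > 1" "q > 1" using eta pq by (auto simp: \<theta>_def)
  have "real N * \<eta> \<le> real N * (1 / (2 * real N))" using N by (intro mult_left_mono) (auto simp: \<eta>_def)
  also have "\<dots> = 1 / 2" using N by simp
  finally have N\<eta>: "real N * \<eta> < p" using pq by simp
  define r where "r = p / (1 - \<theta>)"
  have Nr: "real N < r" using N\<eta> eta by (simp add: r_def \<theta>_def field_simps)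
  define a where "a = q / (1 - \<theta>)"
  define b where "b = (q * \<theta> - 1) / a"
  have a1: "a > 1" using th unfolding a_def by (simp add: less_divide_eq)
  have b0: "b > 0" using a1 th by (simp add: b_def)
  obtain C where C: "C > 0"
    "\<And>t. \<bar>sat a b t\<bar> powr p \<le> C * dsat a b t powr (p - 1) * (\<bar>t\<bar> powr q * \<bar>sat a b t\<bar>) powr \<theta>"
    using sat_growth[OF pq(1,2) th a_def b_def] by blast
  \<comment> \<open>Large enough for k(1-\<theta>) \<ge> p in the absorption, and at least 2 for a
    C^1 cutoff.\<close>
  define k where "k = nat \<lceil>p / (1 - \<theta>)\<rceil> + 2"
  have "real k \<ge> p / (1 - \<theta>)" unfolding k_def by linarith
  then have k: "real k * (1 - \<theta>) \<ge> p" "k \<ge> 2" using th by (auto simp: field_simps k_def)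
  \<comment> \<open>The flux coercivity \<open>c1\<close> may be spent entirely, but only half of
    \<open>c2\<close>; the other half is what \<open>key\<close> retains on the left.\<close>
  define e where "e = min c1 (c2 / 2)"
  have e: "e > 0" "e \<le> c1" "e \<le> c2 / 2" using FG gz by (auto simp: e_def)
  obtain C' where C': "C' > 0"
    "\<And>f g g' y m D. f \<ge> 0 \<Longrightarrow> g \<ge> 0 \<Longrightarrow> g' \<ge> 0 \<Longrightarrow> y \<ge> 0 \<Longrightarrow> 0 \<le> m \<Longrightarrow> m \<le> 1 \<Longrightarrow> D \<ge> 0 \<Longrightarrow>
       g powr p \<le> C * g' powr (p - 1) * (y * g) powr \<theta> \<Longrightarrow>
       f * g * (D * m ^ (k - 1)) \<le> e * (m ^ k * g' * f powr (p / (p - 1))) + e * (m ^ k * (y * g)) + C' * D powr (p / (1 - \<theta>))"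
    using absorb_flux_term[OF pq(1) th(1,2) k e(1) C(1)] by blast
  have s: "1 < p / (p - 1)" "1 / p + 1 / (p / (p - 1)) = 1" using pq by (auto simp: field_simps)
  have [measurable]: "z \<in> borel_measurable borel" using z by (auto simp: loc_pow_int_def)
  have "continuous_on UNIV (sat a b)"
    by (rule DERIV_continuous_on[where D = "dsat a b"]) (use sat_has_derivative[OF a1 b0] has_field_derivative_at_within in blast)
  then have [measurable]: "sat a b \<in> borel_measurable borel" by (rule borel_measurable_continuous_onI)
  define Y where "Y x = \<bar>z x\<bar> powr q * \<bar>sat a b (z x)\<bar>" for x
  have Y0: "Y x \<ge> 0" for x by (simp add: Y_def)
  have [measurable]: "Y \<in> borel_measurable borel" unfolding Y_def by measurable
  \<comment> \<open>The gradient bound D = 2k/R raised to the power \<open>r\<close>, times the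
    volume of the ball of radius \<open>R\<close>, leaves A R^(N-r).\<close>
  define A where "A = C' * (2 * real k) powr r * unit_ball_vol (real N)"
  have key: "(\<integral>\<^sup>+x. ennreal (c2 / 2 * (bump k R x * Y x)) \<partial>lborel) \<le> ennreal (A * R powr (real N - r))" if R: "R > 0" for R
  proof -
    define H where "H x = dsat a b (z x) * bump k R x * (F x \<bullet> G x) + sat a b (z x) * (F x \<bullet> dbump k R x)
        + g x * (sat a b (z x) * bump k R x)" for x
    have t: "test_fun (bump k R :: 'a \<Rightarrow> real) (dbump k R)" by (rule test_fun_bump[OF R k(2)])
    have ab: "\<bar>sat a b t\<bar> \<le> max 1 (a * b)" "\<bar>dsat a b t\<bar> \<le> max 1 (a * b)" for t
      using abs_sat_le_1[OF b0, of a t] dsat_le[OF a1 b0, of t] by auto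
    have H: "integrable lborel H" "(\<integral>x. H x \<partial>lborel) = 0"
      using extended_test[OF z G F g pq(1) s weak eqn sat_has_derivative[OF a1 b0] continuous_dsat[OF a1] ab t]
      unfolding H_def by blast+
    define D where "D = 2 * real k / R"
    define B where "B x = C' * D powr r * indicator (cball 0 R) x" for x :: 'a
    have B: "integrable lborel B" "(\<integral>x. B x \<partial>lborel) = A * R powr (real N - r)"
    proof -
      show "integrable lborel B" unfolding B_def
        using emeasure_cball_finite[where 'a='a] by (intro integrable_mult_right integrable_real_indicator) auto
      have "(\<integral>x. B x \<partial>lborel) = C' * D powr r * (unit_ball_vol (real N) * R ^ N)"
        using R by (simp add: B_def content_cball N_def)
      also have "\<dots> = A * R powr (real N - r)"
        using R by (simp add: A_def D_def powr_divide powr_diff powr_realpow)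
      finally show "(\<integral>x. B x \<partial>lborel) = A * R powr (real N - r)" .
    qed
    have pw: "c2 / 2 * (bump k R x * Y x) \<le> H x + B x" for x
    proof -
      define m where "m = max 0 (1 - (x \<bullet> x) / R\<^sup>2)"
      have m: "0 \<le> m" "m \<le> 1" by (auto simp: m_def)
      have bm: "bump k R x = m ^ k" by (simp add: bump_def m_def)
      have db: "norm (dbump k R x) \<le> D * m ^ (k - 1)"
        using norm_dbump_le[OF R k(2), of x] by (simp add: D_def m_def)
      define f where "f = norm (F x)"
      define \<gamma> where "\<gamma> = \<bar>sat a b (z x)\<bar>"
      define \<gamma>' where "\<gamma>' = dsat a b (z x)"
      have nn: "f \<ge> 0" "\<gamma> \<ge> 0" "\<gamma>' \<ge> 0" using dsat_nonneg[of a b] a1 b0 by (auto simp: f_def \<gamma>_def \<gamma>'_def)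
      have flux: "f * \<gamma> * (D * m ^ (k - 1)) \<le> e * (m ^ k * \<gamma>' * f powr (p / (p - 1))) + e * (m ^ k * (\<bar>z x\<bar> powr q * \<gamma>)) + B x"
      proof (cases "norm x \<le> R")
        case True
        have "f * \<gamma> * (D * m ^ (k - 1)) \<le> e * (m ^ k * \<gamma>' * f powr (p / (p - 1))) + e * (m ^ k * (\<bar>z x\<bar> powr q * \<gamma>)) + C' * D powr (p / (1 - \<theta>))"
          using nn m R C(2)[of "z x"] by (intro C'(2)) (auto simp: D_def \<gamma>_def \<gamma>'_def)
        then show ?thesis using True by (simp add: B_def r_def)
      next
        case False
        have "bump 1 R x = 0" by (rule bump_eq_0) (use False R in auto)
        then have "m = 0" by (simp add: bump_def m_def)
        then show ?thesis using k(2) nn e(1) C'(1) by (simp add: B_def power_0_left)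
      qed
      have "\<bar>sat a b (z x) * (F x \<bullet> dbump k R x)\<bar> \<le> \<gamma> * (f * (D * m ^ (k - 1)))"
      proof -
        have "\<bar>F x \<bullet> dbump k R x\<bar> \<le> norm (F x) * norm (dbump k R x)" by (rule Cauchy_Schwarz_ineq2)
        also have "\<dots> \<le> f * (D * m ^ (k - 1))" using db by (simp add: f_def mult_left_mono)
        finally show ?thesis unfolding abs_mult \<gamma>_def by (intro mult_left_mono) auto
      qed
      then have 1: "sat a b (z x) * (F x \<bullet> dbump k R x) \<ge> - (f * \<gamma> * (D * m ^ (k - 1)))" by (simp add: mult_ac)
      have 2: "\<gamma>' * m ^ k * (F x \<bullet> G x) \<ge> e * (m ^ k * \<gamma>' * f powr (p / (p - 1)))"
      proof -
        have "e * f powr (p / (p - 1)) \<le> c1 * f powr (p / (p - 1))" using e by (intro mult_right_mono) auto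
        also have "\<dots> \<le> F x \<bullet> G x" using FG(2)[of x] by (simp add: f_def)
        finally have "(\<gamma>' * m ^ k) * (e * f powr (p / (p - 1))) \<le> (\<gamma>' * m ^ k) * (F x \<bullet> G x)"
          using nn m by (intro mult_left_mono) auto
        then show ?thesis by (simp add: mult_ac)
      qed
      \<comment> \<open>Dividing the hypothesis on \<open>g x * z x\<close> by |z x| bounds g sgn(z)
        from below, and \<open>sat\<close> has the sign of its argument.\<close>
      have 3: "g x * sat a b (z x) \<ge> c2 * (\<bar>z x\<bar> powr q * \<gamma>)"
      proof (cases "z x = 0")
        case False
        have "c2 * \<bar>z x\<bar> powr (q + 1) = c2 * \<bar>z x\<bar> powr q * \<bar>z x\<bar>" using False by (simp add: powr_add)
        moreover have "g x * z x = g x * sgn (z x) * \<bar>z x\<bar>" by (simp add: mult.assoc sgn_mult_abs)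
        ultimately have "c2 * \<bar>z x\<bar> powr q * \<bar>z x\<bar> \<le> g x * sgn (z x) * \<bar>z x\<bar>" using gz(2)[of x] by linarith
        then have "c2 * \<bar>z x\<bar> powr q \<le> g x * sgn (z x)" using False by simp
        then have "c2 * \<bar>z x\<bar> powr q * \<gamma> \<le> g x * sgn (z x) * \<gamma>" using nn by (intro mult_right_mono) auto
        also have "\<dots> = g x * sat a b (z x)"
          using False b0 by (simp add: \<gamma>_def abs_sat) (simp add: sat_def)
        finally show ?thesis by (simp add: mult.assoc)
      qed (simp add: \<gamma>_def sat_def)
      then have "m ^ k * (c2 * (\<bar>z x\<bar> powr q * \<gamma>)) \<le> m ^ k * (g x * sat a b (z x))"
        using m by (intro mult_left_mono) auto
      then have 4: "c2 * (m ^ k * (\<bar>z x\<bar> powr q * \<gamma>)) \<le> g x * (sat a b (z x) * m ^ k)" by (simp add: mult_ac)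
      have 5: "e * (m ^ k * (\<bar>z x\<bar> powr q * \<gamma>)) \<le> c2 / 2 * (m ^ k * (\<bar>z x\<bar> powr q * \<gamma>))"
        using e m nn by (intro mult_right_mono) auto
      have "H x = \<gamma>' * m ^ k * (F x \<bullet> G x) + sat a b (z x) * (F x \<bullet> dbump k R x) + g x * (sat a b (z x) * m ^ k)"
        by (simp add: H_def bm \<gamma>'_def)
      then have "c2 / 2 * (m ^ k * (\<bar>z x\<bar> powr q * \<gamma>)) \<le> H x + B x" using 1 2 4 5 flux by linarith
      then show ?thesis by (simp add: bm Y_def \<gamma>_def)
    qed
    have HB: "integrable lborel (\<lambda>x. H x + B x)" using H(1) B(1) by simp
    \<comment> \<open>\<open>H\<close> integrates to 0 but its sign is not known;
      \<open>H + B\<close> dominates a nonnegative function, so its nonnegative integral equals the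
      integral of \<open>B\<close>.\<close>
    have "H x + B x \<ge> 0" for x
      using pw[of x] Y0[of x] gz(1) bump_nonneg[of k R x] by (meson divide_nonneg_pos less_imp_le mult_nonneg_nonneg order_trans zero_less_numeral)
    then have "(\<integral>\<^sup>+x. ennreal (H x + B x) \<partial>lborel) = ennreal (\<integral>x. H x + B x \<partial>lborel)"
      using HB by (intro nn_integral_eq_integral) auto
    also have "(\<integral>x. H x + B x \<partial>lborel) = A * R powr (real N - r)"
      using Bochner_Integration.integral_add[OF H(1) B(1)] H(2) B(2) by simp
    finally have "(\<integral>\<^sup>+x. ennreal (H x + B x) \<partial>lborel) = ennreal (A * R powr (real N - r))" .
    moreover have "(\<integral>\<^sup>+x. ennreal (c2 / 2 * (bump k R x * Y x)) \<partial>lborel) \<le> (\<integral>\<^sup>+x. ennreal (H x + B x) \<partial>lborel)"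
      by (intro nn_integral_mono ennreal_leI pw)
    ultimately show ?thesis by simp
  qed
  define d where "d = c2 / 2 * (3/4) ^ k"
  have d: "d > 0" using gz by (simp add: d_def)
  have loc: "AE x in lborel. norm x \<le> real n \<longrightarrow> z x = 0" for n
  proof -
    \<comment> \<open>\<open>I\<close> does not depend on \<open>R\<close>: with \<open>n\<close>
      fixed, R \<rightarrow> \<infinity> in \<open>Ile\<close> forces I = 0.\<close>
    define I where "I = (\<integral>\<^sup>+x. ennreal (d * Y x) * indicator (cball 0 (real n)) x \<partial>lborel)"
    have Ile: "I \<le> ennreal (A * R powr (real N - r))" if R: "R > 0" "R \<ge> 2 * real n" for R
    proof -
      have "I \<le> (\<integral>\<^sup>+x. ennreal (c2 / 2 * (bump k R x * Y x)) \<partial>lborel)" unfolding I_def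
      proof (rule nn_integral_mono)
        fix x :: 'a
        show "ennreal (d * Y x) * indicator (cball 0 (real n)) x \<le> ennreal (c2 / 2 * (bump k R x * Y x))"
        proof (cases "norm x \<le> real n")
          case True
          then have "(3/4) ^ k \<le> bump k R x" using R by (intro bump_ge) auto
          then have "c2 / 2 * ((3/4) ^ k * Y x) \<le> c2 / 2 * (bump k R x * Y x)"
            using gz(1) Y0 by (intro mult_left_mono mult_right_mono) auto
          then show ?thesis using True by (simp add: d_def mult.assoc ennreal_leI)
        qed simp
      qed
      also have "\<dots> \<le> ennreal (A * R powr (real N - r))" by (rule key[OF R(1)])
      finally show ?thesis .
    qed
    have "((\<lambda>R. A * R powr (real N - r)) \<longlongrightarrow> A * 0) at_top"
      using Nr by (intro tendsto_intros tendsto_neg_powr filterlim_ident) auto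
    then have "((\<lambda>R. ennreal (A * R powr (real N - r))) \<longlongrightarrow> ennreal 0) at_top"
      by (intro tendsto_ennrealI) simp
    moreover have "\<forall>\<^sub>F R in at_top. I \<le> ennreal (A * R powr (real N - r))"
      using eventually_gt_at_top[of 0] eventually_ge_at_top[of "2 * real n"] by eventually_elim (rule Ile)
    ultimately have "I \<le> ennreal 0" by (intro tendsto_lowerbound) auto
    then have "I = 0" by simp
    then have "AE x in lborel. ennreal (d * Y x) * indicator (cball 0 (real n)) x = 0"
      unfolding I_def by (subst (asm) nn_integral_0_iff_AE) auto
    then show ?thesis
    proof (rule AE_mp, intro AE_I2 impI)
      fix x :: 'a assume "ennreal (d * Y x) * indicator (cball 0 (real n)) x = 0" "norm x \<le> real n"
      then have "d * Y x \<le> 0" by (simp add: ennreal_eq_0_iff)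
      then have "Y x = 0" using d Y0[of x] by (simp add: mult_le_0_iff)
      then show "z x = 0" using abs_sat_pos[OF b0, of "z x" a] by (auto simp: Y_def)
    qed
  qed
  have "AE x in lborel. \<forall>n. norm x \<le> real n \<longrightarrow> z x = 0" using loc by (subst AE_all_countable) simp
  then show ?thesis
  proof (rule AE_mp, intro AE_I2 impI)
    fix x :: 'a assume a: "\<forall>n. norm x \<le> real n \<longrightarrow> z x = 0"
    obtain n :: nat where "norm x \<le> real n" using real_arch_simple by blast
    then show "z x = 0" using a by blast
  qed
qed

section \<open>From Lebesgue measurable data to Borel representatives\<close>

text \<open>The solution concept is phrased over \<open>lebesgue\<close>, the analysis over
  \<open>lborel\<close>. Real functions measurable for the completion have Borel versions; vectors
  are treated one coordinate at a time.\<close>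

lemma borel_representative:
  fixes f :: "'a::euclidean_space \<Rightarrow> 'b::euclidean_space"
  assumes "f \<in> borel_measurable lebesgue"
  obtains f' where "f' \<in> borel_measurable borel" "AE x in lebesgue. f x = f' x"
proof -
  have "\<forall>i. \<exists>h. h \<in> borel_measurable borel \<and> (AE x in lborel. f x \<bullet> i = h x)"
  proof
    fix i
    have "(\<lambda>x. f x \<bullet> i) \<in> borel_measurable lebesgue"
      using assms by (intro borel_measurable_inner borel_measurable_const)
    from completion_ex_borel_measurable_real[OF this]
    show "\<exists>h. h \<in> borel_measurable borel \<and> (AE x in lborel. f x \<bullet> i = h x)"
      by (simp add: Bex_def)
  qed
  from choice[OF this] obtain h where
    h: "\<And>i. h i \<in> borel_measurable borel" "\<And>i. AE x in lborel. f x \<bullet> i = h i x"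
    by blast
  show ?thesis
  proof (rule that[of "\<lambda>x. \<Sum>i\<in>Basis. h i x *\<^sub>R i"])
    show "(\<lambda>x. \<Sum>i\<in>Basis. h i x *\<^sub>R i) \<in> borel_measurable borel" using h(1) by measurable
    have "AE x in lborel. \<forall>i\<in>Basis. f x \<bullet> i = h i x" using h(2) by (intro AE_finite_allI) auto
    then have "AE x in lborel. f x = (\<Sum>i\<in>Basis. h i x *\<^sub>R i)"
    proof eventually_elim
      case (elim x)
      have "f x = (\<Sum>i\<in>Basis. (f x \<bullet> i) *\<^sub>R i)" by (rule euclidean_representation[symmetric])
      also have "\<dots> = (\<Sum>i\<in>Basis. h i x *\<^sub>R i)" using elim by (intro sum.cong) auto
      finally show ?case .
    qed
    then show "AE x in lebesgue. f x = (\<Sum>i\<in>Basis. h i x *\<^sub>R i)" by (rule AE_completion)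
  qed
qed

text \<open>Completeness of \<open>lebesgue\<close> passes measurability from \<open>f'\<close> to
  \<open>f\<close>, so the integrals may be compared.\<close>

lemma lebesgue_integral_borel_representative:
  fixes f f' :: "'a::euclidean_space \<Rightarrow> real"
  assumes "f' \<in> borel_measurable borel" "AE x in lebesgue. f x = f' x"
  shows "(\<integral>x. f x \<partial>lebesgue) = (\<integral>x. f' x \<partial>lborel)"
proof -
  have m': "f' \<in> borel_measurable lebesgue" using assms(1) by (intro measurable_completion) simp
  have "AE x in lebesgue. f' x = f x" using assms(2) by eventually_elim simp
  from borel_measurable_AE[OF m' this] have "f \<in> borel_measurable lebesgue" .
  then have "(\<integral>x. f x \<partial>lebesgue) = (\<integral>x. f' x \<partial>lebesgue)" by (rule integral_cong_AE[OF _ m' assms(2)])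
  also have "\<dots> = (\<integral>x. f' x \<partial>lborel)" using assms(1) by (intro integral_completion) simp
  finally show ?thesis .
qed

lemma Lp_loc_loc_pow_int:
  fixes f :: "'a::euclidean_space \<Rightarrow> 'b::euclidean_space"
  assumes "Lp_loc r (\<lambda>x. norm (f x))" "f' \<in> borel_measurable borel" "AE x in lebesgue. f x = f' x"
  shows "loc_pow_int r f'"
  unfolding loc_pow_int_def
proof (intro conjI allI)
  show "f' \<in> borel_measurable borel" by fact
  fix \<rho>
  note [measurable] = assms(2)
  have "set_integrable lebesgue (cball 0 \<rho>) (\<lambda>x. \<bar>norm (f x)\<bar> powr r)"
    using assms(1) by (auto simp: Lp_loc_def)
  then have i: "integrable lebesgue (\<lambda>x. indicator (cball 0 \<rho>) x *\<^sub>R (norm (f x) powr r))"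
    by (simp add: set_integrable_def)
  have m: "(\<lambda>x. indicat_real (cball 0 \<rho>) x *\<^sub>R (norm (f' x) powr r)) \<in> borel_measurable lborel" by measurable
  have "integrable lebesgue (\<lambda>x. indicat_real (cball 0 \<rho>) x *\<^sub>R (norm (f' x) powr r))"
  proof (rule integrable_cong_AE_imp[OF i])
    show "(\<lambda>x. indicat_real (cball 0 \<rho>) x *\<^sub>R (norm (f' x) powr r)) \<in> borel_measurable lebesgue"
      using m by (rule measurable_completion)
    show "AE x in lebesgue. indicat_real (cball 0 \<rho>) x *\<^sub>R (norm (f x) powr r) = indicat_real (cball 0 \<rho>) x *\<^sub>R (norm (f' x) powr r)"
      using assms(3) by eventually_elim simp
  qed
  then have "integrable lborel (\<lambda>x. indicat_real (cball 0 \<rho>) x *\<^sub>R (norm (f' x) powr r))"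
    using m by (simp only: integrable_completion)
  then have "(\<integral>\<^sup>+x. ennreal (norm (indicat_real (cball 0 \<rho>) x *\<^sub>R (norm (f' x) powr r))) \<partial>lborel) < \<infinity>"
    by (simp only: integrable_iff_bounded)
  also have "(\<integral>\<^sup>+x. ennreal (norm (indicat_real (cball 0 \<rho>) x *\<^sub>R (norm (f' x) powr r))) \<partial>lborel)
     = (\<integral>\<^sup>+x. ennreal (norm (f' x) powr r) * indicator (cball 0 \<rho>) x \<partial>lborel)"
    by (intro nn_integral_cong) (auto simp: indicator_def)
  finally show "(\<integral>\<^sup>+x. ennreal (norm (f' x) powr r) * indicator (cball 0 \<rho>) x \<partial>lborel) < \<infinity>" .
qed

lemma loc_pow_int_bound:
  fixes f :: "'a::euclidean_space \<Rightarrow> 'b::euclidean_space" and g h :: "'a \<Rightarrow> 'c::euclidean_space"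
  assumes f: "f \<in> borel_measurable borel" and g: "loc_pow_int p g" and h: "loc_pow_int p h" and C: "C \<ge> 0"
    and le: "\<And>x. norm (f x) powr s \<le> C * (norm (g x) powr p + norm (h x) powr p)"
  shows "loc_pow_int s f"
  unfolding loc_pow_int_def
proof (intro conjI allI)
  show "f \<in> borel_measurable borel" by fact
  have [measurable]: "g \<in> borel_measurable borel" "h \<in> borel_measurable borel"
    using g h by (auto simp: loc_pow_int_def)
  fix r
  have "(\<integral>\<^sup>+x. ennreal (norm (f x) powr s) * indicator (cball 0 r) x \<partial>lborel)
    \<le> (\<integral>\<^sup>+x. ennreal C * (ennreal (norm (g x) powr p) * indicator (cball 0 r) x + ennreal (norm (h x) powr p) * indicator (cball 0 r) x) \<partial>lborel)"
  proof (rule nn_integral_mono)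
    fix x
    have "ennreal (norm (f x) powr s) \<le> ennreal (C * (norm (g x) powr p + norm (h x) powr p))"
      by (rule ennreal_leI[OF le])
    then show "ennreal (norm (f x) powr s) * indicator (cball 0 r) x
      \<le> ennreal C * (ennreal (norm (g x) powr p) * indicator (cball 0 r) x + ennreal (norm (h x) powr p) * indicator (cball 0 r) x)"
      using C by (auto simp: indicator_def ennreal_mult)
  qed
  also have "\<dots> < \<infinity>"
    using g h by (simp add: nn_integral_cmult nn_integral_add ennreal_mult_less_top loc_pow_int_def)
  finally show "(\<integral>\<^sup>+x. ennreal (norm (f x) powr s) * indicator (cball 0 r) x \<partial>lborel) < \<infinity>" .
qed

lemma loc_pow_int_add:
  fixes f g :: "'a::euclidean_space \<Rightarrow> 'b::euclidean_space"
  assumes "loc_pow_int p f" "loc_pow_int p g" "p \<ge> 0"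
  shows "loc_pow_int p (\<lambda>x. f x + g x)"
proof (rule loc_pow_int_bound[OF _ assms(1,2), where C = "2 powr p"])
  show "(\<lambda>x. f x + g x) \<in> borel_measurable borel" using assms(1,2) by (auto simp: loc_pow_int_def)
  fix x
  have "norm (f x + g x) powr p \<le> (norm (f x) + norm (g x)) powr p"
    using assms(3) by (intro powr_mono2 norm_triangle_ineq) auto
  also have "\<dots> \<le> 2 powr p * (norm (f x) powr p + norm (g x) powr p)"
    using assms(3) by (intro powr_add_le) auto
  finally show "norm (f x + g x) powr p \<le> 2 powr p * (norm (f x) powr p + norm (g x) powr p)" .
qed simp

text \<open>The weak equations are identities between Bochner integrals; they can be added only once
  every integrand is known to be integrable.\<close>

lemma test_fun_integrable:
  fixes f :: "'a::euclidean_space \<Rightarrow> real" and V :: "'a \<Rightarrow> 'a"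
  assumes t: "test_fun phi dphi" and f: "loc_pow_int 1 f" and V: "loc_pow_int 1 V"
  shows "integrable lborel (\<lambda>x. f x * phi x)" "integrable lborel (\<lambda>x. f x * (dphi x \<bullet> e))"
    "integrable lborel (\<lambda>x. V x \<bullet> dphi x)" "integrable lborel (\<lambda>x. (V x \<bullet> e) * phi x)"
proof -
  obtain r where r: "r > 0" "\<And>x. norm x > r \<Longrightarrow> phi x = 0" "\<And>x. norm x > r \<Longrightarrow> dphi x = 0"
    using test_fun_support[OF t] by blast
  obtain B where B: "B > 0" "\<And>x. \<bar>phi x\<bar> \<le> B" "\<And>x. norm (dphi x) \<le> B"
    using test_fun_bounded[OF t] by blast
  have fi: "set_integrable lborel (cball 0 r) f" and Vi: "set_integrable lborel (cball 0 r) V"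
    using f V by (auto intro: loc_pow_int_set_integrable)
  have [measurable]: "f \<in> borel_measurable borel" "V \<in> borel_measurable borel"
    using f V by (auto simp: loc_pow_int_def)
  have [measurable]: "phi \<in> borel_measurable borel" "dphi \<in> borel_measurable borel"
    using test_fun_continuous[OF t] by (auto intro: borel_measurable_continuous_onI)
  have dB: "\<bar>dphi x \<bullet> y\<bar> \<le> B * norm y" for x y
    using B(3)[of x] by (intro order_trans[OF Cauchy_Schwarz_ineq2] mult_right_mono) auto
  have eB: "\<bar>V x \<bullet> e\<bar> \<le> norm e * norm (V x)" for x
    using Cauchy_Schwarz_ineq2[of "V x" e] by (simp add: mult.commute)
  show "integrable lborel (\<lambda>x. f x * phi x)"
  proof (rule integrable_loc_bound[OF _ fi, where B = B])
    show "norm (f x * phi x) \<le> B * norm (f x)" for x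
      using mult_right_mono[OF B(2)[of x], of "\<bar>f x\<bar>"] by (simp add: abs_mult mult.commute)
  qed (use r in auto)
  show "integrable lborel (\<lambda>x. f x * (dphi x \<bullet> e))"
  proof (rule integrable_loc_bound[OF _ fi, where B = "B * norm e"])
    show "norm (f x * (dphi x \<bullet> e)) \<le> B * norm e * norm (f x)" for x
      using mult_right_mono[OF dB[of x e], of "\<bar>f x\<bar>"] by (simp add: abs_mult mult.commute)
  qed (use r in auto)
  show "integrable lborel (\<lambda>x. V x \<bullet> dphi x)"
    by (rule integrable_loc_bound[OF _ Vi, where B = B])
       (use dB r in \<open>auto simp: inner_commute\<close>)
  show "integrable lborel (\<lambda>x. (V x \<bullet> e) * phi x)"
  proof (rule integrable_loc_bound[OF _ Vi, where B = "norm e * B"])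
    fix x
    have "\<bar>V x \<bullet> e\<bar> * \<bar>phi x\<bar> \<le> (norm e * norm (V x)) * B" using eB B by (intro mult_mono) auto
    then show "norm ((V x \<bullet> e) * phi x) \<le> norm e * B * norm (V x)" by (simp add: abs_mult mult_ac)
  qed (use r in auto)
qed

section \<open>The p-Laplace system\<close>

lemma weak_sol_system_antisymmetric:
  fixes u v :: "'a::euclidean_space \<Rightarrow> real"
  assumes q: "q > 1" and p: "1 < p" "p \<le> 2" and sol: "weak_sol_system p q u v"
  shows "AE x in lebesgue. u x = - v x"
proof -
  obtain Gu Gv where Wu: "W1p_loc_grad p u Gu" and Wv: "W1p_loc_grad p v Gv"
    and qu: "Lp_loc q u" and qv: "Lp_loc q v"
    and eqn: "\<And>phi dphi. test_fun phi dphi \<Longrightarrow>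
          - (\<integral>x. norm (Gu x) powr (p - 2) * (Gu x \<bullet> dphi x) \<partial>lebesgue)
            = (\<integral>x. \<bar>v x\<bar> powr (q - 1) * v x * phi x \<partial>lebesgue) \<and>
          - (\<integral>x. norm (Gv x) powr (p - 2) * (Gv x \<bullet> dphi x) \<partial>lebesgue)
            = (\<integral>x. \<bar>u x\<bar> powr (q - 1) * u x * phi x \<partial>lebesgue)"
    using sol unfolding weak_sol_system_def by blast
  have ml[measurable]: "u \<in> borel_measurable lebesgue" "v \<in> borel_measurable lebesgue"
    "Gu \<in> borel_measurable lebesgue" "Gv \<in> borel_measurable lebesgue"
    using Wu Wv by (auto simp: W1p_loc_grad_def weak_grad_def Lp_loc_def)
  obtain u' where u'[measurable]: "u' \<in> borel_measurable borel" and uu: "AE x in lebesgue. u x = u' x"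
    using borel_representative[OF ml(1)] by blast
  obtain v' where v'[measurable]: "v' \<in> borel_measurable borel" and vv: "AE x in lebesgue. v x = v' x"
    using borel_representative[OF ml(2)] by blast
  obtain Gu' where Gu'[measurable]: "Gu' \<in> borel_measurable borel" and Guu: "AE x in lebesgue. Gu x = Gu' x"
    using borel_representative[OF ml(3)] by blast
  obtain Gv' where Gv'[measurable]: "Gv' \<in> borel_measurable borel" and Gvv: "AE x in lebesgue. Gv x = Gv' x"
    using borel_representative[OF ml(4)] by blast
  have abs_norm: "Lp_loc t w \<Longrightarrow> Lp_loc t (\<lambda>x. norm (w x))" for t and w :: "'a \<Rightarrow> real"
    by (auto simp: Lp_loc_def)
  have pu: "loc_pow_int p u'" and pv: "loc_pow_int p v'" and pGu: "loc_pow_int p Gu'" and pGv: "loc_pow_int p Gv'"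
    and pqu: "loc_pow_int q u'" and pqv: "loc_pow_int q v'"
    using Wu Wv Lp_loc_loc_pow_int[OF abs_norm u' uu] Lp_loc_loc_pow_int[OF abs_norm v' vv] qu qv
      Lp_loc_loc_pow_int[OF _ Gu' Guu] Lp_loc_loc_pow_int[OF _ Gv' Gvv]
    unfolding W1p_loc_grad_def by blast+
  have gu: "(\<integral>x. u' x * (dphi x \<bullet> e) \<partial>lborel) = - (\<integral>x. (Gu' x \<bullet> e) * phi x \<partial>lborel)"
   and gv: "(\<integral>x. v' x * (dphi x \<bullet> e) \<partial>lborel) = - (\<integral>x. (Gv' x \<bullet> e) * phi x \<partial>lborel)"
   and eu: "(\<integral>x. norm (Gu' x) powr (p - 2) * (Gu' x \<bullet> dphi x) \<partial>lborel) = - (\<integral>x. \<bar>v' x\<bar> powr (q - 1) * v' x * phi x \<partial>lborel)"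
   and ev: "(\<integral>x. norm (Gv' x) powr (p - 2) * (Gv' x \<bullet> dphi x) \<partial>lborel) = - (\<integral>x. \<bar>u' x\<bar> powr (q - 1) * u' x * phi x \<partial>lborel)"
   if t: "test_fun phi dphi" for phi dphi e
  proof -
    have [measurable]: "phi \<in> borel_measurable borel" "dphi \<in> borel_measurable borel"
      using test_fun_continuous[OF t] by (auto intro: borel_measurable_continuous_onI)
    have "(\<integral>x. u x * (dphi x \<bullet> e) \<partial>lebesgue) = (\<integral>x. u' x * (dphi x \<bullet> e) \<partial>lborel)"
      by (rule lebesgue_integral_borel_representative) (measurable, use uu in \<open>eventually_elim, simp\<close>)
    moreover have "(\<integral>x. (Gu x \<bullet> e) * phi x \<partial>lebesgue) = (\<integral>x. (Gu' x \<bullet> e) * phi x \<partial>lborel)"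
      by (rule lebesgue_integral_borel_representative) (measurable, use Guu in \<open>eventually_elim, simp\<close>)
    moreover have "(\<integral>x. u x * (dphi x \<bullet> e) \<partial>lebesgue) = - (\<integral>x. (Gu x \<bullet> e) * phi x \<partial>lebesgue)"
      using Wu t by (simp add: W1p_loc_grad_def weak_grad_def)
    ultimately show "(\<integral>x. u' x * (dphi x \<bullet> e) \<partial>lborel) = - (\<integral>x. (Gu' x \<bullet> e) * phi x \<partial>lborel)" by simp
    have "(\<integral>x. v x * (dphi x \<bullet> e) \<partial>lebesgue) = (\<integral>x. v' x * (dphi x \<bullet> e) \<partial>lborel)"
      by (rule lebesgue_integral_borel_representative) (measurable, use vv in \<open>eventually_elim, simp\<close>)
    moreover have "(\<integral>x. (Gv x \<bullet> e) * phi x \<partial>lebesgue) = (\<integral>x. (Gv' x \<bullet> e) * phi x \<partial>lborel)"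
      by (rule lebesgue_integral_borel_representative) (measurable, use Gvv in \<open>eventually_elim, simp\<close>)
    moreover have "(\<integral>x. v x * (dphi x \<bullet> e) \<partial>lebesgue) = - (\<integral>x. (Gv x \<bullet> e) * phi x \<partial>lebesgue)"
      using Wv t by (simp add: W1p_loc_grad_def weak_grad_def)
    ultimately show "(\<integral>x. v' x * (dphi x \<bullet> e) \<partial>lborel) = - (\<integral>x. (Gv' x \<bullet> e) * phi x \<partial>lborel)" by simp
    have "(\<integral>x. norm (Gu x) powr (p - 2) * (Gu x \<bullet> dphi x) \<partial>lebesgue) = (\<integral>x. norm (Gu' x) powr (p - 2) * (Gu' x \<bullet> dphi x) \<partial>lborel)"
      by (rule lebesgue_integral_borel_representative) (measurable, use Guu in \<open>eventually_elim, simp\<close>)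
    moreover have "(\<integral>x. \<bar>v x\<bar> powr (q - 1) * v x * phi x \<partial>lebesgue) = (\<integral>x. \<bar>v' x\<bar> powr (q - 1) * v' x * phi x \<partial>lborel)"
      by (rule lebesgue_integral_borel_representative) (measurable, use vv in \<open>eventually_elim, simp\<close>)
    ultimately show "(\<integral>x. norm (Gu' x) powr (p - 2) * (Gu' x \<bullet> dphi x) \<partial>lborel) = - (\<integral>x. \<bar>v' x\<bar> powr (q - 1) * v' x * phi x \<partial>lborel)"
      using eqn[OF t] by simp
    have "(\<integral>x. norm (Gv x) powr (p - 2) * (Gv x \<bullet> dphi x) \<partial>lebesgue) = (\<integral>x. norm (Gv' x) powr (p - 2) * (Gv' x \<bullet> dphi x) \<partial>lborel)"
      by (rule lebesgue_integral_borel_representative) (measurable, use Gvv in \<open>eventually_elim, simp\<close>)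
    moreover have "(\<integral>x. \<bar>u x\<bar> powr (q - 1) * u x * phi x \<partial>lebesgue) = (\<integral>x. \<bar>u' x\<bar> powr (q - 1) * u' x * phi x \<partial>lborel)"
      by (rule lebesgue_integral_borel_representative) (measurable, use uu in \<open>eventually_elim, simp\<close>)
    ultimately show "(\<integral>x. norm (Gv' x) powr (p - 2) * (Gv' x \<bullet> dphi x) \<partial>lborel) = - (\<integral>x. \<bar>u' x\<bar> powr (q - 1) * u' x * phi x \<partial>lborel)"
      using eqn[OF t] by simp
  qed
  define Fu where "Fu x = norm (Gu' x) powr (p - 2) *\<^sub>R Gu' x" for x
  define Fv where "Fv x = norm (Gv' x) powr (p - 2) *\<^sub>R Gv' x" for x
  define fu where "fu x = \<bar>u' x\<bar> powr (q - 1) * u' x" for x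
  define fv where "fv x = \<bar>v' x\<bar> powr (q - 1) * v' x" for x
  let ?s = "p / (p - 1)"
  have [measurable]: "Fu \<in> borel_measurable borel" "Fv \<in> borel_measurable borel"
    "fu \<in> borel_measurable borel" "fv \<in> borel_measurable borel"
    unfolding Fu_def Fv_def fu_def fv_def by measurable
  \<comment> \<open>|Fu| = |Gu'|^(p-1), so the conjugate exponent turns local L^p of the gradients
    into local L^(p/(p-1)) of the fluxes.\<close>
  have nF: "norm (Fu x) powr ?s = norm (Gu' x) powr p" "norm (Fv x) powr ?s = norm (Gv' x) powr p" for x
    using p by (simp_all add: Fu_def Fv_def norm_p_flux powr_powr del: norm_scaleR)
  \<comment> \<open>The odd power is a flux with exponent q+1 in one dimension, which gives |fu| =
    |u'|^q.\<close>
  have nf: "norm (fu x) powr 1 = norm (u' x) powr q" "norm (fv x) powr 1 = norm (v' x) powr q" for x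
    using norm_p_flux[of "u' x" "q + 1"] norm_p_flux[of "v' x" "q + 1"] by (simp_all add: fu_def fv_def)
  have LF: "loc_pow_int ?s Fu" "loc_pow_int ?s Fv"
    using pGu pGv by (simp_all add: loc_pow_int_def nF)
  have Lf: "loc_pow_int 1 fu" "loc_pow_int 1 fv"
    using pqu pqv unfolding loc_pow_int_def nf by simp_all
  note one = loc_pow_int_mono[OF _ zero_le_one]
  have p1: "1 \<le> p" using p by simp
  have s1: "?s \<ge> 1" using p by (simp add: field_simps)
  have "AE x in lborel. u' x + v' x = 0"
  proof (rule absorption_liouville[OF p q])
    show "loc_pow_int p (\<lambda>x. u' x + v' x)" "loc_pow_int p (\<lambda>x. Gu' x + Gv' x)"
      "loc_pow_int ?s (\<lambda>x. Fu x + Fv x)" "loc_pow_int 1 (\<lambda>x. fu x + fv x)"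
      using pu pv pGu pGv LF Lf p s1 by (auto intro!: loc_pow_int_add)
    show "(\<integral>x. (u' x + v' x) * (dphi x \<bullet> e) \<partial>lborel) = - (\<integral>x. ((Gu' x + Gv' x) \<bullet> e) * phi x \<partial>lborel)"
      if t: "test_fun phi dphi" for phi dphi e
      using gu[OF t, of e] gv[OF t, of e] test_fun_integrable[OF t one[OF pu p1] one[OF pGu p1]]
        test_fun_integrable[OF t one[OF pv p1] one[OF pGv p1]]
      by (simp add: distrib_right inner_add_left)
    show "(\<integral>x. (Fu x + Fv x) \<bullet> dphi x + (fu x + fv x) * phi x \<partial>lborel) = 0"
      if t: "test_fun phi dphi" for phi dphi
    proof -
      note i = test_fun_integrable[OF t Lf(1) one[OF LF(1) s1]] test_fun_integrable[OF t Lf(2) one[OF LF(2) s1]]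
      have "(\<integral>x. (Fu x + Fv x) \<bullet> dphi x + (fu x + fv x) * phi x \<partial>lborel)
        = (\<integral>x. Fu x \<bullet> dphi x \<partial>lborel) + (\<integral>x. Fv x \<bullet> dphi x \<partial>lborel) + ((\<integral>x. fu x * phi x \<partial>lborel) + (\<integral>x. fv x * phi x \<partial>lborel))"
        using i by (simp add: distrib_right inner_add_left)
      \<comment> \<open>The equations are crossed: the flux of \<open>u\<close> pairs with the power
        of \<open>v\<close> and conversely, so the four terms cancel only in the sum.\<close>
      also have "(\<integral>x. Fu x \<bullet> dphi x \<partial>lborel) = - (\<integral>x. fv x * phi x \<partial>lborel)" using eu[OF t] by (simp add: Fu_def fv_def)
      also have "(\<integral>x. Fv x \<bullet> dphi x \<partial>lborel) = - (\<integral>x. fu x * phi x \<partial>lborel)" using ev[OF t] by (simp add: Fv_def fu_def)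
      finally show ?thesis by simp
    qed
    show "2 powr (1 - ?s) * norm (Fu x + Fv x) powr ?s \<le> (Fu x + Fv x) \<bullet> (Gu' x + Gv' x)" for x
      unfolding Fu_def Fv_def by (rule p_flux_strongly_monotone[OF p])
    show "2 powr (- q) * \<bar>u' x + v' x\<bar> powr (q + 1) \<le> (fu x + fv x) * (u' x + v' x)" for x
      unfolding fu_def fv_def by (rule odd_power_strongly_monotone[OF q])
  qed auto
  then have "AE x in lebesgue. u' x + v' x = 0" by (rule AE_completion)
  then show ?thesis using uu vv by eventually_elim simp
qed

text \<open>The power is odd, so inserting v = -u in the first equation flips the sign of its
  right-hand side. The statement for \<open>v\<close> follows by exchanging the roles of the
  components.\<close>

lemma weak_sol_scalar_of_system:
  assumes sol: "weak_sol_system p q u v" and uv: "AE x in lebesgue. u x = - v x"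
  shows "weak_sol_scalar p q u"
proof -
  obtain Gu where Wu: "W1p_loc_grad p u Gu" and L: "Lp_loc q u" "Lp_loc q v"
    and eqn: "\<And>phi dphi. test_fun phi dphi \<Longrightarrow>
          - (\<integral>x. norm (Gu x) powr (p - 2) * (Gu x \<bullet> dphi x) \<partial>lebesgue)
            = (\<integral>x. \<bar>v x\<bar> powr (q - 1) * v x * phi x \<partial>lebesgue)"
    using sol unfolding weak_sol_system_def by blast
  have [measurable]: "u \<in> borel_measurable lebesgue" "v \<in> borel_measurable lebesgue"
    using L by (auto simp: Lp_loc_def)
  show ?thesis unfolding weak_sol_scalar_def
  proof (intro exI conjI allI impI)
    fix phi :: "'a \<Rightarrow> real" and dphi assume t: "test_fun phi dphi"
    have "phi \<in> borel_measurable borel"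
      using test_fun_continuous[OF t] by (auto intro: borel_measurable_continuous_onI)
    then have [measurable]: "phi \<in> borel_measurable lebesgue" by (intro measurable_completion) simp
    have "(\<integral>x. \<bar>v x\<bar> powr (q - 1) * v x * phi x \<partial>lebesgue) = (\<integral>x. - (\<bar>u x\<bar> powr (q - 1) * u x * phi x) \<partial>lebesgue)"
    proof (rule integral_cong_AE)
      show "AE x in lebesgue. \<bar>v x\<bar> powr (q - 1) * v x * phi x = - (\<bar>u x\<bar> powr (q - 1) * u x * phi x)"
        using uv by eventually_elim simp
    qed measurable
    then show "(\<integral>x. norm (Gu x) powr (p - 2) * (Gu x \<bullet> dphi x) \<partial>lebesgue) = (\<integral>x. \<bar>u x\<bar> powr (q - 1) * u x * phi x \<partial>lebesgue)"
      using eqn[OF t] by simp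
  qed (fact Wu L(1))+
qed

lemma weak_sol_system_commute: "weak_sol_system p q u v \<Longrightarrow> weak_sol_system p q v u"
  unfolding weak_sol_system_def by blast

theorem theorem1p4:
  fixes u v :: "'a::euclidean_space \<Rightarrow> real" and p q :: real
  assumes "q > 1" and "1 < p" and "p \<le> 2"
    and "weak_sol_system p q u v"
  shows "(AE x in lebesgue. u x = - v x) \<and> weak_sol_scalar p q u \<and> weak_sol_scalar p q v
         \<and> ((AE x in lebesgue. u x \<ge> 0) \<and> (AE x in lebesgue. v x \<ge> 0)
              \<longrightarrow> (AE x in lebesgue. u x = 0) \<and> (AE x in lebesgue. v x = 0))"
proof (intro conjI impI)
  show uv: "AE x in lebesgue. u x = - v x" by (rule weak_sol_system_antisymmetric[OF assms])
  then have vu: "AE x in lebesgue. v x = - u x" by eventually_elim simp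
  show "weak_sol_scalar p q u" by (rule weak_sol_scalar_of_system[OF assms(4) uv])
  show "weak_sol_scalar p q v" by (rule weak_sol_scalar_of_system[OF weak_sol_system_commute[OF assms(4)] vu])
  assume nonneg: "(AE x in lebesgue. u x \<ge> 0) \<and> (AE x in lebesgue. v x \<ge> 0)"
  show "AE x in lebesgue. u x = 0" using conjunct1[OF nonneg] conjunct2[OF nonneg] uv by eventually_elim simp
  show "AE x in lebesgue. v x = 0" using conjunct1[OF nonneg] conjunct2[OF nonneg] uv by eventually_elim simp
qed

end
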